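(* Let $G$ be a finite group and let $\chi\in\operatorname{Irr}(G)$. Let $\Xi$ be the class function on $G$ defined by $\Xi(g)=|G|\,o(g)$ for $g\in G$. Let $\{\alpha_1,\dots,\alpha_t\}$ be a complete set of representatives of the Galois orbits on the set of values $\{\chi(x)\mid x\in G\}$. Then $$[\Xi,\chi]=\sum_{i=1}^t\psi(G_{\chi,\alpha_i})\,\operatorname{Tr}_{\mathbb{Q}(\alpha_i)/\mathbb{Q}}(\alpha_i).$$ In particular, if $\lambda\in\operatorname{Irr}(G)$ is linear, $K=\operatorname{Ker}\lambda$, $m=|G:K|$, and $gK$ is a generator of the cyclic group $G/K$, then $$[\Xi,\lambda]=\sum_{d\mid m}\psi(g^dK)\,\mu(m/d),$$ where the sum is over the positive divisors $d$ of $m$ and $\mu$ is the Möbius function.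
   Context: $\operatorname{Irr}(G)$ is the set of irreducible complex characters of $G$, and a character is linear if it has degree $1$. For $g\in G$, $o(g)$ denotes the order of the element $g$. For a subset $\mathcal{S}\subseteq G$, $\psi(\mathcal{S})=\sum_{x\in\mathcal{S}}o(x)$; in particular $\psi(g^dK)$ is the sum of the orders (in $G$) of the elements of the coset $g^dK$. For $\chi\in\operatorname{Irr}(G)$ and $\alpha\in\mathbb{C}$, $G_{\chi,\alpha}=\{g\in G\mid\chi(g)=\alpha\}$. For class functions $\varphi,\theta$ on $G$, $[\varphi,\theta]=\frac{1}{|G|}\sum_{x\in G}\varphi(x)\overline{\theta(x)}$ is the usual inner product. The values of $\chi$ lie in a cyclotomic field, and two values are in the same Galois orbit if they are conjugate over $\mathbb{Q}$, i.e. one is the image of the other under a Galois automorphism; $\{\alpha_1,\dots,\alpha_t\}$ contains exactly one element of each orbit. $\operatorname{Tr}_{\mathbb{Q}(\alpha)/\mathbb{Q}}$ is the field trace. *)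

theory Defs
  imports
    "HOL-Algebra.Algebra"
    "HOL-Algebra.Algebraic_Closure_Type"
    "HOL-Computational_Algebra.Squarefree"
    "Jordan_Normal_Form.VS_Connect"
begin

section \<open>Irreducible complex characters\<close>

definition mat_trace :: "complex mat \<Rightarrow> complex" where
  "mat_trace A = (\<Sum>i<dim_row A. A $$ (i, i))"

definition GL :: "nat \<Rightarrow> complex mat monoid" where
  "GL n = units_of (ring_mat TYPE(complex) n ())"

definition irreducible_rep ::
    "('a, 'b) monoid_scheme \<Rightarrow> nat \<Rightarrow> ('a \<Rightarrow> complex mat) \<Rightarrow> bool" where
  "irreducible_rep G n \<rho> \<longleftrightarrow>
     n > 0 \<and> \<rho> \<in> hom G (GL n) \<and>
     (\<forall>W. VectorSpace.subspace class_ring W (module_vec TYPE(complex) n) \<and>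
          (\<forall>g\<in>carrier G. \<forall>w\<in>W. \<rho> g *\<^sub>v w \<in> W) \<longrightarrow>
          W = {0\<^sub>v n} \<or> W = carrier_vec n)"

text \<open>Characters are taken to be \<^const>\<open>undefined\<close> outside the group, so that each character of
  the group is represented by exactly one function.\<close>

definition Irr :: "('a, 'b) monoid_scheme \<Rightarrow> ('a \<Rightarrow> complex) set" where
  "Irr G = {\<chi>. \<exists>n \<rho>. irreducible_rep G n \<rho> \<and> \<chi> = (\<lambda>g\<in>carrier G. mat_trace (\<rho> g))}"

definition linear_char :: "('a, 'b) monoid_scheme \<Rightarrow> ('a \<Rightarrow> complex) \<Rightarrow> bool" where
  "linear_char G \<chi> \<longleftrightarrow> \<chi> \<one>\<^bsub>G\<^esub> = 1"

definition char_ker :: "('a, 'b) monoid_scheme \<Rightarrow> ('a \<Rightarrow> complex) \<Rightarrow> 'a set" where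
  "char_ker G \<chi> = {g \<in> carrier G. \<chi> g = \<chi> \<one>\<^bsub>G\<^esub>}"

definition char_inner ::
    "('a, 'b) monoid_scheme \<Rightarrow> ('a \<Rightarrow> complex) \<Rightarrow> ('a \<Rightarrow> complex) \<Rightarrow> complex" where
  "char_inner G \<phi> \<theta> = 1 / of_nat (Coset.order G) * (\<Sum>x\<in>carrier G. \<phi> x * cnj (\<theta> x))"

section \<open>Sums of element orders\<close>

definition psi :: "('a, 'b) monoid_scheme \<Rightarrow> 'a set \<Rightarrow> nat" where
  "psi G S = (\<Sum>x\<in>S. group.ord G x)"

definition value_fibre ::
    "('a, 'b) monoid_scheme \<Rightarrow> ('a \<Rightarrow> complex) \<Rightarrow> complex \<Rightarrow> 'a set" where
  "value_fibre G \<chi> \<alpha> = {g \<in> carrier G. \<chi> g = \<alpha>}"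

definition Xi :: "('a, 'b) monoid_scheme \<Rightarrow> 'a \<Rightarrow> complex" where
  "Xi G g = of_nat (Coset.order G) * of_nat (group.ord G g)"

section \<open>Galois orbits and field traces\<close>

definition rat_adjoin :: "complex \<Rightarrow> complex set" where
  "rat_adjoin \<alpha> = generate_field (ring_of_type_algebra :: complex ring) {\<alpha>}"

text \<open>The values of a character of a group of order \<open>n\<close> are sums of \<open>n\<close>-th roots of unity, so
  they lie in the field below, which is Galois over the rationals. Its ring automorphisms are
  automatically the identity on the rationals.\<close>

definition cyclotomic_field :: "nat \<Rightarrow> complex ring" where
  "cyclotomic_field n =
     (ring_of_type_algebra :: complex ring)
       \<lparr>carrier := rat_adjoin (cis (2 * pi / of_nat n))\<rparr>"

definition galois_conj :: "nat \<Rightarrow> complex \<Rightarrow> complex \<Rightarrow> bool" where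
  "galois_conj n \<alpha> \<beta> \<longleftrightarrow>
     (\<exists>\<sigma> \<in> ring_iso (cyclotomic_field n) (cyclotomic_field n). \<sigma> \<alpha> = \<beta>)"

definition galois_orbit_reps ::
    "('a, 'b) monoid_scheme \<Rightarrow> ('a \<Rightarrow> complex) \<Rightarrow> complex set \<Rightarrow> bool" where
  "galois_orbit_reps G \<chi> R \<longleftrightarrow>
     R \<subseteq> \<chi> ` carrier G \<and>
     (\<forall>\<beta> \<in> \<chi> ` carrier G. \<exists>!\<alpha>. \<alpha> \<in> R \<and> galois_conj (Coset.order G) \<alpha> \<beta>)"

global_interpretation rat_vs: vector_space "\<lambda>(q::rat) (z::complex). of_rat q * z"
  by unfold_locales (simp_all add: algebra_simps of_rat_add of_rat_mult)

text \<open>The trace of multiplication by \<open>a\<close> on a field \<open>K\<close> of finite degree over the rationals, read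
  off from a basis of \<open>K\<close>; it does not depend on which basis is chosen.\<close>

definition field_trace :: "complex set \<Rightarrow> complex \<Rightarrow> rat" where
  "field_trace K a =
     (let B = (SOME B. rat_vs.independent B \<and> rat_vs.span B = K)
      in \<Sum>b\<in>B. rat_vs.representation B (a * b) b)"

section \<open>The Moebius function\<close>

definition moebius_mu :: "nat \<Rightarrow> int" where
  "moebius_mu n = (if squarefree n then (- 1) ^ card (prime_factors n) else 0)"

end

theory Submission
  imports Defs "HOL-Number_Theory.Cong" "Jordan_Normal_Form.Schur_Decomposition"
begin

text \<open>Put \<open>N = |G|\<close> and \<open>\<zeta> = exp (2 \<pi> \<i> / N)\<close>. Since \<open>\<rho> x\<close> has \<open>N\<close>-th roots of unity as
  eigenvalues, \<open>\<chi> (x\<^sup>k)\<close> arises from \<open>\<chi> x\<close> by the substitution \<open>\<zeta> \<mapsto> \<zeta>\<^sup>k\<close>; for \<open>k\<close> prime to \<open>N\<close>,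
  \<open>x \<mapsto> x\<^sup>k\<close> permutes \<open>G\<close> and preserves element orders, so \<open>\<psi>\<close> is constant on the fibres over a
  Galois orbit. Summing \<open>o(x) \<chi>(x)\<close> fibre by fibre leaves the orbit sums, and an orbit sum is the
  trace because the product of the \<open>X - \<beta>\<close> over an orbit is the rational minimal polynomial. An
  element \<open>r(\<zeta>)\<close> fixed by all automorphisms is rational since \<open>r - r(\<zeta>)\<close> then has more roots than
  its degree allows once \<open>r\<close> is reduced; no irreducibility of cyclotomic polynomials is involved.

  For a linear character, \<open>\<psi>(g\<^sup>i K)\<close> depends only on \<open>d = gcd(i, m)\<close> (a unit modulo \<open>m / d\<close> lifts to
  a unit modulo \<open>N\<close>), and the \<open>\<omega>\<^sup>i\<close> with \<open>gcd(i, m) = d\<close> are the primitive \<open>m / d\<close>-th roots of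
  unity, whose sum is \<open>\<mu>(m / d)\<close>.\<close>

section \<open>Rational polynomials at complex numbers\<close>

text \<open>Elements of the field generated by an algebraic number \<open>z\<close> are handled as
  values \<open>rat_eval p z\<close>; an automorphism then acts by moving the point and leaving
  \<open>p\<close> alone.\<close>

definition rat_eval :: "rat poly \<Rightarrow> complex \<Rightarrow> complex" where
  "rat_eval p z = poly (map_poly of_rat p) z"

lemma rat_eval_0 [simp]: "rat_eval 0 z = 0"
  and rat_eval_pCons [simp]: "rat_eval (pCons a p) z = of_rat a + z * rat_eval p z"
  by (simp_all add: rat_eval_def Polynomial.map_poly_pCons)

lemma rat_eval_1 [simp]: "rat_eval 1 z = 1"
  by (simp add: one_pCons)

lemma rat_eval_add [simp]: "rat_eval (p + q) z = rat_eval p z + rat_eval q z"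
  by (induction p q rule: poly_induct2) (simp_all add: of_rat_add algebra_simps)

lemma rat_eval_smult [simp]: "rat_eval (Polynomial.smult a p) z = of_rat a * rat_eval p z"
  by (induction p) (simp_all add: of_rat_mult algebra_simps)

lemma rat_eval_uminus [simp]: "rat_eval (- p) z = - rat_eval p z"
  using rat_eval_smult[of "-1" p z] by simp

lemma rat_eval_diff [simp]: "rat_eval (p - q) z = rat_eval p z - rat_eval q z"
  using rat_eval_add[of p "- q" z] by simp

lemma rat_eval_mult [simp]: "rat_eval (p * q) z = rat_eval p z * rat_eval q z"
  by (induction p) (simp_all add: algebra_simps)

lemma rat_eval_power [simp]: "rat_eval (p ^ n) z = rat_eval p z ^ n"
  by (induction n) simp_all

lemma rat_eval_sum [simp]: "rat_eval (sum f A) z = (\<Sum>x\<in>A. rat_eval (f x) z)"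
  by (induction A rule: infinite_finite_induct) simp_all

lemma rat_eval_monom [simp]: "rat_eval (Polynomial.monom a n) z = of_rat a * z ^ n"
  by (induction n) (simp_all add: Polynomial.monom_Suc monom_0 algebra_simps)

lemma rat_eval_altdef:
  assumes "Polynomial.degree p < n"
  shows "rat_eval p z = (\<Sum>i<n. of_rat (Polynomial.coeff p i) * z ^ i)"
proof -
  have "p = (\<Sum>i<n. Polynomial.monom (Polynomial.coeff p i) i)"
    by (rule poly_eqI)
       (use assms in \<open>simp add: Polynomial.coeff_sum coeff_eq_0 if_distrib sum.delta cong: if_cong\<close>)
  hence "rat_eval p z = rat_eval (\<Sum>i<n. Polynomial.monom (Polynomial.coeff p i) i) z"
    by simp
  thus ?thesis by simp
qed

text \<open>Minimality is by degree, up to a scalar; \<open>rat_minpoly_bezout\<close> extracts from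
  it what irreducibility would give.\<close>

definition rat_minpoly :: "rat poly \<Rightarrow> complex \<Rightarrow> bool" where
  "rat_minpoly m z \<longleftrightarrow> m \<noteq> 0 \<and> rat_eval m z = 0 \<and>
     (\<forall>q. q \<noteq> 0 \<longrightarrow> rat_eval q z = 0 \<longrightarrow> Polynomial.degree m \<le> Polynomial.degree q)"

lemma rat_minpoly_exists:
  assumes "p \<noteq> 0" "rat_eval p z = 0"
  obtains m where "rat_minpoly m z"
proof -
  define P where "P q \<longleftrightarrow> q \<noteq> 0 \<and> rat_eval q z = 0" for q
  have "P p" using assms by (simp add: P_def)
  from arg_min_natI[of P, OF this] arg_min_nat_le[of P _ Polynomial.degree] that
  show ?thesis unfolding rat_minpoly_def P_def by blast
qed

text \<open>A nonzero remainder of division by \<open>m\<close> would vanish at \<open>z\<close> and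
  have smaller degree than \<open>m\<close>.\<close>

lemma rat_minpoly_dvd:
  assumes "rat_minpoly m z" "rat_eval q z = 0"
  shows "m dvd q"
proof (rule ccontr)
  assume "\<not> m dvd q"
  hence nz: "q mod m \<noteq> 0" by (simp add: dvd_eq_mod_eq_0)
  have "rat_eval (q mod m) z = rat_eval (q - m * (q div m)) z"
    by (simp add: minus_mult_div_eq_mod)
  also have "\<dots> = 0" using assms by (simp add: rat_minpoly_def)
  finally have "Polynomial.degree m \<le> Polynomial.degree (q mod m)"
    using assms nz by (simp add: rat_minpoly_def)
  moreover have "Polynomial.degree (q mod m) < Polynomial.degree m"
    using degree_mod_less[of m q] nz assms by (auto simp: rat_minpoly_def)
  ultimately show False by simp
qed

text \<open>The gcd of \<open>p\<close> and \<open>m\<close> cannot vanish at \<open>z\<close>,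
  since \<open>p\<close> does not, so the cofactor \<open>h\<close> in \<open>m\<close> does.
  Minimality forces \<open>h\<close> to have full degree, hence the gcd is constant.\<close>

lemma rat_minpoly_bezout:
  assumes m: "rat_minpoly m z" and p: "rat_eval p z \<noteq> 0"
  obtains a b where "a * p + b * m = 1"
proof -
  obtain h where h: "m = gcd p m * h" by (meson dvdE gcd_dvd2)
  obtain k where k: "p = gcd p m * k" by (meson dvdE gcd_dvd1)
  have "rat_eval (gcd p m) z \<noteq> 0"
    using p by (subst (asm) k) auto
  moreover have "rat_eval (gcd p m * h) z = 0"
    using m h by (simp add: rat_minpoly_def)
  ultimately have "rat_eval h z = 0" by simp
  moreover have "m \<noteq> 0" using m by (simp add: rat_minpoly_def)
  hence nz: "h \<noteq> 0" "gcd p m \<noteq> 0" using h by auto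
  ultimately have "Polynomial.degree m \<le> Polynomial.degree h"
    using m by (simp add: rat_minpoly_def)
  moreover have "Polynomial.degree m = Polynomial.degree (gcd p m) + Polynomial.degree h"
    by (subst h) (use nz in \<open>simp add: Polynomial.degree_mult_eq\<close>)
  ultimately have "Polynomial.degree (gcd p m) = 0" by simp
  hence "is_unit (gcd p m)" using nz is_unit_iff_degree by blast
  hence "gcd p m = 1" by (metis is_unit_gcd_iff)
  thus ?thesis using that bezout_coefficients_fst_snd[of p m] by metis
qed

section \<open>The field generated by one algebraic number\<close>

lemma carrier_type_algebra [simp]: "carrier (ring_of_type_algebra :: complex ring) = UNIV"
  and mult_type_algebra [simp]: "monoid.mult (ring_of_type_algebra :: complex ring) = (*)"
  and one_type_algebra [simp]: "\<one>\<^bsub>(ring_of_type_algebra :: complex ring)\<^esub> = 1"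
  and zero_type_algebra [simp]: "\<zero>\<^bsub>(ring_of_type_algebra :: complex ring)\<^esub> = 0"
  and add_type_algebra [simp]: "ring.add (ring_of_type_algebra :: complex ring) = (+)"
  by (simp_all add: ring_of_type_algebra_def fun_eq_iff)

lemma a_inv_type_algebra [simp]: "a_inv (ring_of_type_algebra :: complex ring) x = - x"
proof -
  interpret cr: Ring.field "ring_of_type_algebra :: complex ring"
    by (rule field_from_type_algebra)
  show ?thesis
    using cr.minus_equality[of "- x" x] by simp
qed

lemma m_inv_type_algebra [simp]:
  assumes "x \<noteq> 0"
  shows "m_inv (ring_of_type_algebra :: complex ring) x = inverse x"
proof -
  interpret cr: Ring.field "ring_of_type_algebra :: complex ring"
    by (rule field_from_type_algebra)
  show ?thesis
    using cr.inv_unique'[of x "inverse x"] assms by simp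
qed

text \<open>\<open>generate_field\<close> is given one and \<open>z\<close> only, so rationals are
  rebuilt from one by sums, negatives, products and inverses.\<close>

lemma rat_adjoin_of_rat: "of_rat q \<in> rat_adjoin z"
proof -
  let ?R = "ring_of_type_algebra :: complex ring"
  have one: "1 \<in> rat_adjoin z" using generate_field.one[of ?R] by (simp add: rat_adjoin_def)
  have neg: "- x \<in> rat_adjoin z" if "x \<in> rat_adjoin z" for x
    using generate_field.a_inv[of x ?R] that by (simp add: rat_adjoin_def)
  have add: "x + y \<in> rat_adjoin z" if "x \<in> rat_adjoin z" "y \<in> rat_adjoin z" for x y
    using generate_field.eng_add[of x ?R _ y] that by (simp add: rat_adjoin_def)
  have mult: "x * y \<in> rat_adjoin z" if "x \<in> rat_adjoin z" "y \<in> rat_adjoin z" for x y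
    using generate_field.eng_mult[of x ?R _ y] that by (simp add: rat_adjoin_def)
  have inv: "inverse x \<in> rat_adjoin z" if "x \<in> rat_adjoin z" "x \<noteq> 0" for x
    using generate_field.m_inv[of x ?R] that by (simp add: rat_adjoin_def)
  have zero: "0 \<in> rat_adjoin z" using add[OF one neg[OF one]] by simp
  have nat: "of_nat n \<in> rat_adjoin z" for n
    by (induction n) (auto intro: zero one add)
  have int: "of_int i \<in> rat_adjoin z" for i
    by (cases i rule: int_cases2) (auto intro: nat neg)
  obtain a b where "q = Rat.Fract a b" "b > 0" by (cases q)
  hence "of_rat q = of_int a * inverse (of_int b :: complex)"
    by (simp add: of_rat_rat divide_inverse)
  thus ?thesis using mult[OF int inv[OF int]] \<open>b > 0\<close> by simp
qed

text \<open>Polynomial values are clearly closed under the ring operations. For inverses,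
  \<open>a * p + b * m = 1\<close> is evaluated at \<open>z\<close>, where \<open>m\<close>
  vanishes, so \<open>a\<close> gives the inverse of \<open>p\<close>.\<close>

lemma rat_adjoin_eq:
  assumes m: "rat_minpoly m z"
  shows "rat_adjoin z = range (\<lambda>p. rat_eval p z)"
proof (intro equalityI subsetI)
  fix x assume "x \<in> rat_adjoin z"
  thus "x \<in> range (\<lambda>p. rat_eval p z)"
    unfolding rat_adjoin_def
  proof (induction rule: generate_field.induct)
    case one
    show ?case by (rule range_eqI[of _ _ 1]) simp
  next
    case (incl h)
    thus ?case by (intro range_eqI[of _ _ "[:0, 1:]"]) simp
  next
    case (a_inv h)
    then obtain p where "h = rat_eval p z" by blast
    thus ?case by (intro range_eqI[of _ _ "- p"]) simp
  next
    case (m_inv h)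
    then obtain p where p: "h = rat_eval p z" by blast
    have "rat_eval p z \<noteq> 0" using m_inv p by simp
    then obtain a b where "a * p + b * m = 1" by (rule rat_minpoly_bezout[OF m])
    hence "rat_eval (a * p + b * m) z = 1" by simp
    hence "rat_eval a z * h = 1" using m p by (simp add: rat_minpoly_def)
    hence "inverse h = rat_eval a z"
      by (metis inverse_unique mult.commute)
    thus ?case using m_inv by simp
  next
    case (eng_add x y)
    then obtain p q where "x = rat_eval p z" "y = rat_eval q z" by blast
    thus ?case by (intro range_eqI[of _ _ "p + q"]) simp
  next
    case (eng_mult x y)
    then obtain p q where "x = rat_eval p z" "y = rat_eval q z" by blast
    thus ?case by (intro range_eqI[of _ _ "p * q"]) simp
  qed
next
  fix x assume "x \<in> range (\<lambda>p. rat_eval p z)"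
  then obtain p where p: "x = rat_eval p z" by blast
  let ?R = "ring_of_type_algebra :: complex ring"
  have "rat_eval p z \<in> rat_adjoin z"
  proof (induction p)
    case 0
    show ?case using rat_adjoin_of_rat[of 0 z] by simp
  next
    case (pCons a p)
    have "z \<in> rat_adjoin z" by (simp add: rat_adjoin_def generate_field.incl)
    hence "z * rat_eval p z \<in> rat_adjoin z"
      using generate_field.eng_mult[of z ?R "{z}" "rat_eval p z"] pCons by (simp add: rat_adjoin_def)
    thus ?case
      using generate_field.eng_add[of _ ?R "{z}" "z * rat_eval p z"] rat_adjoin_of_rat[of a z]
      by (simp add: rat_adjoin_def)
  qed
  thus "x \<in> rat_adjoin z" using p by simp
qed

lemma rat_minpoly_degree_pos:
  assumes "rat_minpoly m z"
  shows "Polynomial.degree m > 0"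
proof (rule ccontr)
  assume "\<not> Polynomial.degree m > 0"
  then obtain c where "m = [:c:]" by (meson degree_eq_zeroE not_gr_zero)
  thus False using assms by (simp add: rat_minpoly_def)
qed

lemma rat_eval_mod:
  assumes "rat_eval m z = 0"
  shows "rat_eval (p mod m) z = rat_eval p z"
proof -
  have "rat_eval (p mod m) z = rat_eval (p - m * (p div m)) z"
    by (simp add: minus_mult_div_eq_mod)
  thus ?thesis using assms by simp
qed

lemma degree_mod_rat_minpoly:
  assumes "rat_minpoly m z"
  shows "Polynomial.degree (p mod m) < Polynomial.degree m"
  using degree_mod_less[of m p] rat_minpoly_degree_pos[OF assms] assms by (auto simp: rat_minpoly_def)

section \<open>Traces\<close>

lemma rat_representation_sum_scale:
  assumes D: "rat_vs.independent D" and f: "\<And>c. c \<in> E \<Longrightarrow> f c \<in> rat_vs.span D"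
  shows "rat_vs.representation D (\<Sum>c\<in>E. of_rat (g c) * f c) b
    = (\<Sum>c\<in>E. g c * rat_vs.representation D (f c) b)"
proof -
  have "rat_vs.representation D (\<Sum>c\<in>E. of_rat (g c) * f c)
      = (\<lambda>b. \<Sum>c\<in>E. rat_vs.representation D (of_rat (g c) * f c) b)"
    by (rule rat_vs.representation_sum[OF D]) (rule rat_vs.span_scale[OF f])
  thus ?thesis using f by (simp add: rat_vs.representation_scale[OF D])
qed

text \<open>Expand \<open>a *\<close> each vector of one basis in the other and exchange the two sums.\<close>
lemma basis_trace_independent:
  assumes B: "rat_vs.independent B" "finite B" and C: "rat_vs.independent C" "finite C"
    and span: "rat_vs.span B = K" "rat_vs.span C = K"
    and closed: "\<And>x. x \<in> K \<Longrightarrow> a * x \<in> K"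
  shows "(\<Sum>b\<in>B. rat_vs.representation B (a * b) b) = (\<Sum>c\<in>C. rat_vs.representation C (a * c) c)"
proof -
  let ?RB = "rat_vs.representation B" and ?RC = "rat_vs.representation C"
  have BK: "B \<subseteq> K" and CK: "C \<subseteq> K" using span rat_vs.span_superset by blast+
  have expand: "x = (\<Sum>c\<in>D. of_rat (rat_vs.representation D x c) * c)"
    if "rat_vs.independent D" "finite D" "rat_vs.span D = K" "x \<in> K" for x D
    using rat_vs.sum_representation_eq[OF that(1) _ that(2), of x] that by simp
  have rep_expand: "rat_vs.representation D (\<Sum>c\<in>E. of_rat (g c) * f c) b
      = (\<Sum>c\<in>E. g c * rat_vs.representation D (f c) b)"
    if "rat_vs.independent D" "rat_vs.span D = K" "\<And>c. c \<in> E \<Longrightarrow> f c \<in> K" for D E g f b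
    by (rule rat_representation_sum_scale) (use that in auto)
  have "(\<Sum>b\<in>B. ?RB (a * b) b) = (\<Sum>b\<in>B. \<Sum>c\<in>C. ?RC (a * b) c * ?RB c b)"
  proof (rule sum.cong[OF refl])
    fix b assume "b \<in> B"
    hence ab: "a * b \<in> K" using closed BK by blast
    have "?RB (a * b) b = ?RB (\<Sum>c\<in>C. of_rat (?RC (a * b) c) * c) b"
      using expand[OF C span(2) ab] by simp
    also have "\<dots> = (\<Sum>c\<in>C. ?RC (a * b) c * ?RB c b)"
      using rep_expand[OF B(1) span(1), of C "\<lambda>c. c"] CK by blast
    finally show "?RB (a * b) b = (\<Sum>c\<in>C. ?RC (a * b) c * ?RB c b)" .
  qed
  also have "\<dots> = (\<Sum>c\<in>C. \<Sum>b\<in>B. ?RB c b * ?RC (a * b) c)"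
    by (subst sum.swap) (simp add: mult.commute)
  also have "\<dots> = (\<Sum>c\<in>C. ?RC (a * c) c)"
  proof (rule sum.cong[OF refl])
    fix c assume "c \<in> C"
    hence c: "c \<in> K" using CK by blast
    have "?RC (a * c) c = ?RC (a * (\<Sum>b\<in>B. of_rat (?RB c b) * b)) c"
      using expand[OF B span(1) c] by simp
    also have "a * (\<Sum>b\<in>B. of_rat (?RB c b) * b) = (\<Sum>b\<in>B. of_rat (?RB c b) * (a * b))"
      by (simp add: sum_distrib_left mult_ac)
    also have "?RC \<dots> c = (\<Sum>b\<in>B. ?RB c b * ?RC (a * b) c)"
      using rep_expand[OF C(1) span(2), of B "\<lambda>b. a * b"] BK closed by blast
    finally show "(\<Sum>b\<in>B. ?RB c b * ?RC (a * b) c) = ?RC (a * c) c" by simp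
  qed
  finally show ?thesis .
qed

text \<open>\<open>field_trace\<close> picks its basis by \<open>SOME\<close>. That basis is finite
  because it is an independent set inside the span of the finite set \<open>C\<close>, so
  \<open>basis_trace_independent\<close> allows computing with \<open>C\<close> instead.\<close>

lemma field_trace_eq:
  assumes C: "rat_vs.independent C" "finite C" "rat_vs.span C = K"
    and closed: "\<And>x. x \<in> K \<Longrightarrow> a * x \<in> K"
  shows "field_trace K a = (\<Sum>c\<in>C. rat_vs.representation C (a * c) c)"
proof -
  define B where "B = (SOME B. rat_vs.independent B \<and> rat_vs.span B = K)"
  have B: "rat_vs.independent B \<and> rat_vs.span B = K"
    unfolding B_def by (rule someI[of _ C]) (use C in blast)
  have "finite B"
    using rat_vs.independent_span_bound[of C B] B C rat_vs.span_superset by blast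
  thus ?thesis
    using basis_trace_independent[of B C K a] B C closed
    by (simp add: field_trace_def B_def[symmetric] Let_def)
qed

text \<open>In the basis of powers of \<open>z\<close>, multiplication by \<open>z\<close> is the
  companion matrix of \<open>m\<close>; only its last diagonal entry can be nonzero, and that is
  minus the subleading coefficient.\<close>

lemma field_trace_rat_adjoin:
  assumes m: "rat_minpoly m z" and monic: "Polynomial.lead_coeff m = 1"
  shows "field_trace (rat_adjoin z) z = - Polynomial.coeff m (Polynomial.degree m - 1)"
proof -
  define d where "d = Polynomial.degree m"
  have d: "d > 0" using rat_minpoly_degree_pos[OF m] by (simp add: d_def)
  define C where "C = (\<lambda>i. z ^ i) ` {..<d}"
  have indep0: "\<forall>i<d. g i = 0" if "(\<Sum>i<d. of_rat (g i) * z ^ i) = 0" for g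
  proof (rule ccontr)
    define q where "q = (\<Sum>i<d. Polynomial.monom (g i) i)"
    have coeff: "Polynomial.coeff q i = (if i < d then g i else 0)" for i
      by (simp add: q_def Polynomial.coeff_sum if_distrib sum.delta cong: if_cong)
    assume "\<not> (\<forall>i<d. g i = 0)"
    then obtain i where "i < d" "g i \<noteq> 0" by blast
    hence "q \<noteq> 0" using coeff[of i] by auto
    moreover have "rat_eval q z = 0" using that by (simp add: q_def)
    ultimately have "d \<le> Polynomial.degree q" using m by (simp add: rat_minpoly_def d_def)
    hence "Polynomial.coeff q (Polynomial.degree q) = 0" by (simp add: coeff)
    thus False using \<open>q \<noteq> 0\<close> by simp
  qed
  have inj: "inj_on (\<lambda>i. z ^ i) {..<d}"
  proof (rule inj_onI, rule ccontr)
    fix i j assume ij: "i \<in> {..<d}" "j \<in> {..<d}" "z ^ i = z ^ j" "i \<noteq> j"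
    \<comment> \<open>Equality of two powers is itself a linear relation, with the difference of two
      indicator functions as coefficients.\<close>
    have "(\<Sum>k<d. of_rat ((if k = i then 1 else 0) - (if k = j then 1 else 0)) * z ^ k)
        = (\<Sum>k<d. (if k = i then z ^ k else 0)) - (\<Sum>k<d. (if k = j then z ^ k else 0))"
      by (subst sum_subtractf[symmetric]) (intro sum.cong, auto)
    also have "\<dots> = 0" using ij by simp
    finally have "(if i = i then 1 else 0) - (if i = j then 1 else 0) = (0::rat)"
      using indep0[of "\<lambda>k. (if k = i then 1 else 0) - (if k = j then 1 else 0)"] ij(1) by blast
    thus False using ij(4) by simp
  qed
  have indep: "rat_vs.independent C"
  proof (rule rat_vs.independent_if_scalars_zero)
    show "finite C" by (simp add: C_def)
    fix f x assume f: "(\<Sum>x\<in>C. of_rat (f x) * x) = 0" and x: "x \<in> C"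
    have eq: "(\<Sum>i<d. of_rat (f (z ^ i)) * z ^ i) = 0"
      using f unfolding C_def by (subst (asm) sum.reindex[OF inj]) simp
    from x obtain i where "i < d" "x = z ^ i" by (auto simp: C_def)
    thus "f x = 0" using indep0[OF eq] by blast
  qed
  have span: "rat_vs.span C = rat_adjoin z"
  proof (intro equalityI subsetI)
    fix x assume "x \<in> rat_vs.span C"
    then obtain u where "x = (\<Sum>v\<in>C. of_rat (u v) * v)"
      using rat_vs.span_finite[of C] by (auto simp: C_def)
    also have "\<dots> = (\<Sum>i<d. of_rat (u (z ^ i)) * z ^ i)"
      unfolding C_def by (subst sum.reindex[OF inj]) simp
    also have "\<dots> = rat_eval (\<Sum>i<d. Polynomial.monom (u (z ^ i)) i) z" by simp
    finally show "x \<in> rat_adjoin z" using rat_adjoin_eq[OF m] by blast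
  next
    fix x assume "x \<in> rat_adjoin z"
    then obtain p where "x = rat_eval p z" using rat_adjoin_eq[OF m] by blast
    hence "x = rat_eval (p mod m) z" using m by (simp add: rat_eval_mod rat_minpoly_def)
    also have "\<dots> = (\<Sum>i<d. of_rat (Polynomial.coeff (p mod m) i) * z ^ i)"
      by (rule rat_eval_altdef) (use degree_mod_rat_minpoly[OF m] in \<open>simp add: d_def\<close>)
    also have "\<dots> \<in> rat_vs.span C"
      by (intro rat_vs.span_sum rat_vs.span_scale rat_vs.span_base) (auto simp: C_def)
    finally show "x \<in> rat_vs.span C" .
  qed
  have closed: "z * x \<in> rat_adjoin z" if "x \<in> rat_adjoin z" for x
  proof -
    from that obtain p where "x = rat_eval p z" using rat_adjoin_eq[OF m] by blast
    hence "z * x = rat_eval ([:0, 1:] * p) z" by (simp del: mult_pCons_left)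
    thus ?thesis using rat_adjoin_eq[OF m] by blast
  qed
  \<comment> \<open>The product is the next basis vector, which contributes nothing to the diagonal,
    unless \<open>i = d - 1\<close>; there \<open>m\<close> rewrites \<open>z ^ d\<close> in lower
    powers.\<close>
  have entry: "rat_vs.representation C (z * z ^ i) (z ^ i)
      = (if i = d - 1 then - Polynomial.coeff m i else 0)" if i: "i < d" for i
  proof (cases "i = d - 1")
    case False
    hence "Suc i < d" using i by simp
    hence "z ^ Suc i \<in> C" "z ^ Suc i \<noteq> z ^ i"
      using inj_onD[OF inj, of "Suc i" i] i unfolding C_def
      by (blast, metis lessThan_iff n_not_Suc_n)
    thus ?thesis using rat_vs.representation_basis[OF indep, of "z ^ Suc i"] False by simp
  next
    case True
    have "0 = rat_eval m z" using m by (simp add: rat_minpoly_def)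
    also have "\<dots> = (\<Sum>j<Suc d. of_rat (Polynomial.coeff m j) * z ^ j)"
      by (rule rat_eval_altdef) (simp add: d_def)
    also have "\<dots> = (\<Sum>j<d. of_rat (Polynomial.coeff m j) * z ^ j) + z ^ d"
      using monic by (simp add: d_def)
    finally have zd: "z ^ d = (\<Sum>j<d. of_rat (- Polynomial.coeff m j) * z ^ j)"
      by (simp add: of_rat_minus sum_negf eq_neg_iff_add_eq_0 add.commute)
    have zz: "z * z ^ i = z ^ d" using True d by (metis Suc_pred' power_Suc)
    have "rat_vs.representation C (z * z ^ i) (z ^ i)
        = (\<Sum>j<d. - Polynomial.coeff m j * rat_vs.representation C (z ^ j) (z ^ i))"
      unfolding zz zd
      by (rule rat_representation_sum_scale[OF indep]) (auto simp: C_def intro: rat_vs.span_base)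
    also have "\<dots> = (\<Sum>j<d. if j = i then - Polynomial.coeff m j else 0)"
    proof (rule sum.cong[OF refl])
      fix j assume j: "j \<in> {..<d}"
      hence "z ^ j \<in> C" by (auto simp: C_def)
      thus "- Polynomial.coeff m j * rat_vs.representation C (z ^ j) (z ^ i)
          = (if j = i then - Polynomial.coeff m j else 0)"
        using rat_vs.representation_basis[OF indep, of "z ^ j"] inj_onD[OF inj, of i j] i j by auto
    qed
    also have "\<dots> = - Polynomial.coeff m i" using i by simp
    finally show ?thesis using True by simp
  qed
  have "field_trace (rat_adjoin z) z = (\<Sum>c\<in>C. rat_vs.representation C (z * c) c)"
    by (rule field_trace_eq[OF indep _ span closed]) (simp_all add: C_def)
  also have "\<dots> = (\<Sum>i<d. rat_vs.representation C (z * z ^ i) (z ^ i))"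
    by (subst (1) C_def, subst sum.reindex[OF inj]) simp
  also have "\<dots> = (\<Sum>i<d. if i = d - 1 then - Polynomial.coeff m i else 0)"
    by (rule sum.cong) (use entry in auto)
  also have "\<dots> = - Polynomial.coeff m (d - 1)" using d by simp
  finally show ?thesis by (simp add: d_def)
qed

section \<open>Primitive roots of unity\<close>

text \<open>The order of \<open>w\<close> is exactly \<open>n\<close>, phrased through divisibility;
  \<open>n > 0\<close> excludes numbers that are not roots of unity, which would satisfy the rest
  with \<open>n = 0\<close>.\<close>

definition primitive_root :: "nat \<Rightarrow> complex \<Rightarrow> bool" where
  "primitive_root n w \<longleftrightarrow> n > 0 \<and> (\<forall>d. w ^ d = 1 \<longleftrightarrow> n dvd d)"

lemma primitive_root_power_eq:
  assumes "primitive_root n w"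
  shows "w ^ i = w ^ j \<longleftrightarrow> i mod n = j mod n"
proof -
  have aux: "w ^ i = w ^ j \<longleftrightarrow> i mod n = j mod n" if "i \<le> j" for i j
  proof -
    have "w \<noteq> 0" using assms by (auto simp: primitive_root_def power_0_left dest: spec[of _ n])
    hence "w ^ i = w ^ j \<longleftrightarrow> w ^ (j - i) = 1"
      using that by (auto simp: power_diff)
    also have "\<dots> \<longleftrightarrow> n dvd j - i" using assms by (simp add: primitive_root_def)
    also have "\<dots> \<longleftrightarrow> i mod n = j mod n" using that by (metis mod_eq_dvd_iff_nat)
    finally show ?thesis .
  qed
  show ?thesis using aux[of i j] aux[of j i] by (metis linear)
qed

lemma primitive_root_inj:
  assumes "primitive_root n w"
  shows "inj_on (\<lambda>i. w ^ i) {..<n}"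
  by (rule inj_onI) (use primitive_root_power_eq[OF assms] in auto)

text \<open>The first \<open>n\<close> powers are distinct solutions of an equation that has exactly
  \<open>n\<close> solutions.\<close>

lemma primitive_root_image:
  assumes "primitive_root n w"
  shows "(\<lambda>i. w ^ i) ` {..<n} = {z. z ^ n = 1}"
proof (rule card_subset_eq)
  have n: "n > 0" "w ^ n = 1" using assms by (auto simp: primitive_root_def)
  show "finite {z :: complex. z ^ n = 1}" using n by (intro finite_roots_unity) simp
  show "(\<lambda>i. w ^ i) ` {..<n} \<subseteq> {z. z ^ n = 1}"
  proof safe
    fix i
    have "(w ^ i) ^ n = (w ^ n) ^ i" by (simp add: mult.commute flip: power_mult)
    thus "(w ^ i) ^ n = 1" using n by simp
  qed
  show "card ((\<lambda>i. w ^ i) ` {..<n}) = card {z :: complex. z ^ n = 1}"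
    using n card_image[OF primitive_root_inj[OF assms]] by (simp add: card_roots_unity_eq)
qed

lemma primitive_root_cis:
  assumes "n > 0"
  shows "primitive_root n (cis (2 * pi / of_nat n))"
proof -
  let ?w = "cis (2 * pi / of_nat n)"
  have pow: "?w ^ k = cis (2 * pi * real k / real n)" for k
    by (simp add: Complex.DeMoivre mult_ac)
  have wn: "?w ^ n = 1" using assms by (simp add: pow)
  have "?w ^ d = 1 \<longleftrightarrow> n dvd d" for d
  proof -
    have "?w ^ d = ?w ^ (n * (d div n) + d mod n)" by simp
    also have "\<dots> = ?w ^ (d mod n)" unfolding power_add power_mult wn by simp
    finally have "?w ^ d = ?w ^ (d mod n)" .
    hence "?w ^ d = 1 \<longleftrightarrow> ?w ^ (d mod n) = ?w ^ 0" by simp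
    also have "\<dots> \<longleftrightarrow> d mod n = 0"
      using bij_betw_imp_inj_on[OF bij_betw_roots_unity[OF assms]] assms
      unfolding pow by (subst inj_on_eq_iff[of "\<lambda>k. cis (2 * pi * real k / real n)"]) auto
    finally show ?thesis by auto
  qed
  thus ?thesis using assms by (simp add: primitive_root_def)
qed

lemma primitive_root_power_div:
  assumes w: "primitive_root n w" and "d dvd n"
  shows "primitive_root (n div d) (w ^ d)"
proof -
  obtain e where e: "n = d * e" using assms by blast
  hence "d > 0" "e > 0" using w by (auto simp: primitive_root_def)
  thus ?thesis using w by (auto simp: primitive_root_def e simp flip: power_mult)
qed

section \<open>The Moebius function and sums of primitive roots of unity\<close>

lemma moebius_mu_1 [simp]: "moebius_mu (Suc 0) = 1"
  by (simp add: moebius_mu_def)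

text \<open>This sign change makes the paired divisors cancel in
  \<open>sum_moebius_mu_divisors\<close>.\<close>

lemma moebius_mu_prime_mult:
  assumes p: "Factorial_Ring.prime p" and d: "\<not> p dvd d" "squarefree d"
  shows "moebius_mu (p * d) = - moebius_mu d"
proof -
  have "coprime p d" using p d prime_imp_coprime by blast
  hence "squarefree (p * d)"
    using p d by (simp add: squarefree_mult_coprime squarefree_prime)
  moreover have "d \<noteq> 0" using d by (metis dvd_0_right)
  hence "prime_factors (p * d) = insert p (prime_factors d)"
    using p by (subst prime_factors_product) (auto simp: prime_prime_factors)
  moreover have "p \<notin> prime_factors d" using d by auto
  ultimately show ?thesis using d by (simp add: moebius_mu_def)
qed

text \<open>Multiplication by a fixed prime factor \<open>p\<close> of \<open>n\<close> pairs the squarefree divisors prime to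
  \<open>p\<close> with those divisible by \<open>p\<close>.\<close>
lemma sum_moebius_mu_divisors:
  assumes n: "n > 0"
  shows "(\<Sum>d | d dvd n. moebius_mu d) = (if n = 1 then 1 else 0)"
proof (cases "n = 1")
  case False
  then obtain p where p: "Factorial_Ring.prime p" "p dvd n" using prime_factor_nat by blast
  define A where "A = {d. d dvd n \<and> squarefree d \<and> \<not> p dvd d}"
  have fin: "finite {d. d dvd n}" using n by simp
  have finA: "finite A" by (rule finite_subset[OF _ fin]) (auto simp: A_def)
  have inj: "inj_on ((*) p) A" using p by (auto simp: inj_on_def)
  have img: "{d. d dvd n \<and> squarefree d \<and> p dvd d} = (*) p ` A"
  proof (intro equalityI subsetI)
    fix d assume "d \<in> {d. d dvd n \<and> squarefree d \<and> p dvd d}"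
    then obtain e where e: "d = p * e" "d dvd n" "squarefree d" by auto
    have "\<not> p dvd e"
    proof
      assume "p dvd e"
      hence "p ^ 2 dvd d" by (simp add: e power2_eq_square)
      hence "is_unit p" using e(3) by (auto simp: squarefree_def)
      thus False using p by simp
    qed
    moreover have "e dvd n" using e by (metis dvd_mult_right)
    moreover have "squarefree e" using e by (metis squarefree_multD(2))
    ultimately show "d \<in> (*) p ` A" using e by (auto simp: A_def)
  next
    fix d assume "d \<in> (*) p ` A"
    then obtain e where e: "d = p * e" "e dvd n" "squarefree e" "\<not> p dvd e" by (auto simp: A_def)
    have "coprime p e" using p e prime_imp_coprime by blast
    thus "d \<in> {d. d dvd n \<and> squarefree d \<and> p dvd d}"
      using p e by (simp add: squarefree_mult_coprime squarefree_prime divides_mult)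
  qed
  have "(\<Sum>d | d dvd n. moebius_mu d) = (\<Sum>d | d dvd n \<and> squarefree d. moebius_mu d)"
    by (rule sum.mono_neutral_right[OF fin]) (auto simp: moebius_mu_def)
  also have "{d. d dvd n \<and> squarefree d} = A \<union> (*) p ` A"
    unfolding img[symmetric] by (auto simp: A_def)
  also have "sum moebius_mu \<dots> = sum moebius_mu A + sum moebius_mu ((*) p ` A)"
    by (rule sum.union_disjoint) (use finA in \<open>auto simp: A_def\<close>)
  also have "sum moebius_mu ((*) p ` A) = (\<Sum>d\<in>A. - moebius_mu d)"
    by (subst sum.reindex[OF inj])
       (intro sum.cong, auto simp: A_def moebius_mu_prime_mult[OF p(1)])
  also have "sum moebius_mu A + \<dots> = 0" by (simp add: sum_negf)
  finally show ?thesis using False by simp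
qed simp

lemma sum_gcd_classes:
  fixes f :: "nat \<Rightarrow> 'c :: comm_monoid_add"
  assumes "n > 0"
  shows "(\<Sum>i<n. f i) = (\<Sum>d | d dvd n. \<Sum>i | i < n \<and> gcd i n = d. f i)"
proof -
  have "(\<Sum>d | d dvd n. \<Sum>i | i \<in> {..<n} \<and> gcd i n = d. f i) = (\<Sum>i\<in>{..<n}. f i)"
    by (rule sum.group) (use assms in auto)
  thus ?thesis by simp
qed

text \<open>Dividing by \<open>d\<close> turns the numbers with \<open>gcd i n = d\<close> into
  those prime to \<open>n div d\<close>.\<close>

lemma sum_gcd_class_eq:
  fixes n d :: nat
  assumes n: "n > 0" and d: "d dvd n"
  shows "(\<Sum>i | i < n \<and> gcd i n = d. f i) = (\<Sum>j | j < n div d \<and> coprime j (n div d). f (d * j))"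
proof -
  obtain e where e: "n = d * e" using d by blast
  have pos: "d > 0" "e > 0" using e n by auto
  have "{i. i < n \<and> gcd i n = d} = (*) d ` {j. j < e \<and> coprime j e}"
  proof (intro equalityI subsetI)
    fix i assume i: "i \<in> {i. i < n \<and> gcd i n = d}"
    then obtain j where j: "i = d * j" by (metis (mono_tags) dvdE gcd_dvd1 mem_Collect_eq)
    hence "d * gcd j e = d" using i by (simp add: e gcd_mult_distrib_nat)
    hence "coprime j e" using pos by (simp add: coprime_iff_gcd_eq_1)
    thus "i \<in> (*) d ` {j. j < e \<and> coprime j e}" using i j pos by (auto simp: e)
  next
    fix i assume "i \<in> (*) d ` {j. j < e \<and> coprime j e}"
    then obtain j where j: "i = d * j" "j < e" "coprime j e" by blast
    have "gcd i n = d * gcd j e" by (simp add: j(1) e gcd_mult_distrib_nat)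
    thus "i \<in> {i. i < n \<and> gcd i n = d}" using j pos by (simp add: e)
  qed
  moreover have "inj_on ((*) d) {j. j < e \<and> coprime j e}" using pos by (auto simp: inj_on_def)
  ultimately show ?thesis using pos by (simp add: sum.reindex e)
qed

lemma sum_powers_primitive_root:
  assumes w: "primitive_root n w"
  shows "(\<Sum>i<n. w ^ i) = (if n = 1 then 1 else 0)"
proof (cases "n = 1")
  case False
  hence "\<not> n dvd 1" by auto
  hence "w ^ 1 \<noteq> 1" using w unfolding primitive_root_def by blast
  moreover have "w ^ n = 1" using w by (simp add: primitive_root_def)
  ultimately show ?thesis using geometric_sum[of w n] False by simp
qed simp

text \<open>Strong induction on \<open>n\<close>. Summed over all divisors, the gcd class sums of
  powers and the values of \<mu> give the same total, 1 or 0. The induction hypothesis matches all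
  terms but \<open>d = 1\<close>, so those agree as well.\<close>

lemma sum_primitive_powers:
  "primitive_root n w \<Longrightarrow> (\<Sum>j | j < n \<and> coprime j n. w ^ j) = of_int (moebius_mu n)"
proof (induction n arbitrary: w rule: less_induct)
  case (less n)
  have n: "n > 0" using less.prems by (simp add: primitive_root_def)
  have fin: "finite {d. d dvd n}" using n by simp
  define S where "S d = (\<Sum>i | i < n \<and> gcd i n = d. w ^ i)" for d
  have S: "S d = (\<Sum>j | j < n div d \<and> coprime j (n div d). (w ^ d) ^ j)" if "d dvd n" for d
    unfolding S_def sum_gcd_class_eq[OF n that] by (simp add: power_mult)
  have S': "S d = of_int (moebius_mu (n div d))" if "d \<in> {d. d dvd n} - {1}" for d
  proof -
    have d: "d dvd n" "d \<noteq> 1" "d > 0" using that n by (auto intro: Nat.gr0I)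
    have "n div d < n" using d n by (intro div_less_dividend) auto
    thus ?thesis
      using less.IH[OF _ primitive_root_power_div[OF less.prems d(1)]] S[OF d(1)] by simp
  qed
  have "(\<Sum>d | d dvd n. S d) = (if n = 1 then 1 else 0)"
    using sum_gcd_classes[OF n, of "\<lambda>i. w ^ i"] sum_powers_primitive_root[OF less.prems]
    by (simp add: S_def)
  also have "\<dots> = of_int (\<Sum>d | d dvd n. moebius_mu d)"
    using sum_moebius_mu_divisors[OF n] by simp
  \<comment> \<open>Replacing each divisor by its complement aligns the Moebius terms with the sums
    \<open>S d\<close>, whose roots of unity have order \<open>n div d\<close>.\<close>
  also have "(\<Sum>d | d dvd n. moebius_mu d) = (\<Sum>d | d dvd n. moebius_mu (n div d))"
    by (rule sum.reindex_bij_witness[of _ "\<lambda>d. n div d" "\<lambda>d. n div d"])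
       (use n in \<open>auto simp: div_div_eq_right\<close>)
  finally have "S 1 + (\<Sum>d\<in>{d. d dvd n} - {1}. S d)
      = of_int (moebius_mu n) + (\<Sum>d\<in>{d. d dvd n} - {1}. of_int (moebius_mu (n div d)))"
    using sum.remove[OF fin, of 1 S] sum.remove[OF fin, of 1 "\<lambda>d. of_int (moebius_mu (n div d)) :: complex"]
    by simp
  moreover have "(\<Sum>d\<in>{d. d dvd n} - {1}. S d) = (\<Sum>d\<in>{d. d dvd n} - {1}. of_int (moebius_mu (n div d)))"
    by (rule sum.cong) (use S' in auto)
  ultimately have "S 1 = of_int (moebius_mu n)" by simp
  thus ?case using S[of 1] by simp
qed

text \<open>Take \<open>k = a + m * t\<close> with \<open>t\<close> the product of the primes of
  \<open>N\<close> that do not divide \<open>a\<close>. Each prime of \<open>N\<close> then divides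
  exactly one of \<open>a\<close> and \<open>m * t\<close>, hence not \<open>k\<close>.\<close>

lemma lift_coprime:
  fixes a m N :: nat
  assumes "coprime a m" "N > 0"
  obtains k where "coprime k N" "k mod m = a mod m"
proof -
  define t where "t = \<Prod>{p \<in> prime_factors N. \<not> p dvd a}"
  have "\<not> p dvd a + m * t" if p: "Factorial_Ring.prime p" "p dvd N" for p
  proof (cases "p dvd a")
    case True
    hence "\<not> p dvd m" using assms p by (meson coprime_common_divisor not_prime_unit)
    moreover have "\<not> p dvd t"
    proof
      assume "p dvd t"
      then obtain q where "Factorial_Ring.prime q" "\<not> q dvd a" "p dvd q"
        unfolding t_def using p by (subst (asm) prime_dvd_prod_iff) auto
      thus False using True p primes_dvd_imp_eq by blast
    qed
    ultimately have "\<not> p dvd m * t" using p by (simp add: prime_dvd_mult_iff)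
    thus ?thesis using True by (simp add: dvd_add_right_iff)
  next
    case False
    hence "p dvd t"
      unfolding t_def using p assms by (intro dvd_prodI) (auto simp: prime_factors_dvd)
    thus ?thesis using False by (simp add: dvd_add_left_iff)
  qed
  hence "coprime (a + m * t) N"
    by (meson coprimeI prime_factor_nat not_prime_unit coprime_iff_gcd_eq_1 gcd_dvd1 gcd_dvd2 dvd_trans)
  thus ?thesis using that[of "a + m * t"] by simp
qed

section \<open>Galois conjugation in cyclotomic fields\<close>

lemma degree_map_of_rat [simp]:
  "Polynomial.degree (map_poly of_rat p :: complex poly) = Polynomial.degree p"
  by (rule degree_map_poly) simp

lemma map_of_rat_eq_0_iff [simp]: "(map_poly of_rat p :: complex poly) = 0 \<longleftrightarrow> p = 0"
  by (simp add: poly_eq_iff coeff_map_poly)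

lemma rat_eval_roots:
  assumes "p \<noteq> 0"
  shows "finite {z. rat_eval p z = 0}" "card {z. rat_eval p z = 0} \<le> Polynomial.degree p"
  using poly_roots_finite[of "map_poly of_rat p :: complex poly"]
    card_poly_roots_bound[of "map_poly of_rat p :: complex poly"] assms
  by (simp_all add: rat_eval_def)

lemma rat_eval_pcompose [simp]: "rat_eval (pcompose p q) z = rat_eval p (rat_eval q z)"
  by (induction p) (simp_all add: pcompose_pCons)

text \<open>All roots of \<open>m\<close> satisfy the same rational equations: one direction is
  divisibility by \<open>m\<close>, the other a Bezout identity evaluated at
  \<open>z'\<close>.\<close>

lemma rat_minpoly_root_iff:
  assumes m: "rat_minpoly m z" and z': "rat_eval m z' = 0"
  shows "rat_eval p z' = 0 \<longleftrightarrow> rat_eval p z = 0"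
proof
  assume "rat_eval p z = 0"
  then obtain q where "p = m * q" using rat_minpoly_dvd[OF m] by blast
  thus "rat_eval p z' = 0" using z' by simp
next
  assume p: "rat_eval p z' = 0"
  show "rat_eval p z = 0"
  proof (rule ccontr)
    assume "rat_eval p z \<noteq> 0"
    then obtain a b where "a * p + b * m = 1" by (rule rat_minpoly_bezout[OF m])
    hence "rat_eval (a * p + b * m) z' = 1" by simp
    thus False using p z' by simp
  qed
qed

text \<open>Vieta for the top two coefficients; the second one is found by adding one factor at a
  time. It needs a nonempty set, since \<open>card A - 1\<close> would otherwise truncate to the
  constant coefficient 1.\<close>

lemma coeff_prod_linear:
  fixes A :: "complex set"
  assumes "finite A"
  shows "Polynomial.degree (\<Prod>b\<in>A. [:- b, 1:]) = card A"
    and "Polynomial.coeff (\<Prod>b\<in>A. [:- b, 1:]) (card A) = 1"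
    and "A \<noteq> {} \<Longrightarrow> Polynomial.coeff (\<Prod>b\<in>A. [:- b, 1:]) (card A - 1) = - \<Sum>A"
proof -
  show deg: "Polynomial.degree (\<Prod>b\<in>A. [:- b, 1:]) = card A" for A :: "complex set"
    by (subst Polynomial.degree_prod_sum_eq) auto
  have "Polynomial.lead_coeff (\<Prod>b\<in>A. [:- b, 1:]) = 1" for A :: "complex set"
    by (simp add: Polynomial.lead_coeff_prod)
  thus lc: "Polynomial.coeff (\<Prod>b\<in>A. [:- b, 1:]) (card A) = 1" for A :: "complex set"
    by (simp add: deg)
  show "A \<noteq> {} \<Longrightarrow> Polynomial.coeff (\<Prod>b\<in>A. [:- b, 1:]) (card A - 1) = - \<Sum>A"
    using assms
  proof (induction A rule: finite_induct)
    case (insert b A)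
    show ?case
    proof (cases "A = {}")
      case False
      hence "card A > 0" using insert by (simp add: card_gt_0_iff)
      then obtain k where "card A = Suc k" by (cases "card A") auto
      thus ?thesis using insert False lc[of A] by (simp add: coeff_pCons)
    qed simp
  qed simp
qed

text \<open>The Galois group enters through \<open>conjugates\<close>, the roots of
  \<open>m\<close>: an automorphism amounts to substituting a conjugate for
  \<open>\<zeta>\<close>.\<close>

locale cyclotomic =
  fixes n :: nat and \<zeta> :: complex and m :: "rat poly"
  assumes prim: "primitive_root n \<zeta>" and min: "rat_minpoly m \<zeta>"
begin

abbreviation conjugates :: "complex set" where
  "conjugates \<equiv> {z. rat_eval m z = 0}"

lemma n_pos: "n > 0"
  using prim by (simp add: primitive_root_def)

lemma self_conjugate: "\<zeta> \<in> conjugates"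
  using min by (simp add: rat_minpoly_def)

lemma finite_conjugates: "finite conjugates"
  using rat_eval_roots(1) min by (simp add: rat_minpoly_def)

text \<open>This makes substitution of a conjugate for \<open>\<zeta>\<close> well defined and
  injective on field elements.\<close>

lemma eval_conjugate_iff:
  "z \<in> conjugates \<Longrightarrow> rat_eval p z = rat_eval q z \<longleftrightarrow> rat_eval p \<zeta> = rat_eval q \<zeta>"
  using rat_minpoly_root_iff[OF min, of z "p - q"] by simp

lemma conjugate_primitive:
  assumes "z \<in> conjugates"
  shows "primitive_root n z"
proof -
  have "z ^ d = 1 \<longleftrightarrow> \<zeta> ^ d = 1" for d
    using eval_conjugate_iff[OF assms, of "[:0, 1:] ^ d" 1] by simp
  thus ?thesis using prim by (simp add: primitive_root_def)
qed

text \<open>As an \<open>n\<close>-th root of unity, \<open>z\<close> is some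
  \<open>\<zeta> ^ k\<close>. With \<open>g = gcd k n\<close>, raising it to the power
  \<open>n div g\<close> gives 1, but \<open>z\<close> has order \<open>n\<close>, so
  \<open>g = 1\<close>.\<close>

lemma conjugate_power:
  assumes "z \<in> conjugates"
  obtains k where "coprime k n" "z = \<zeta> ^ k"
proof -
  have z: "primitive_root n z" by (rule conjugate_primitive[OF assms])
  hence "z \<in> {z. z ^ n = 1}" by (simp add: primitive_root_def)
  then obtain k where k: "z = \<zeta> ^ k" using primitive_root_image[OF prim] by blast
  define g where "g = gcd k n"
  have g: "g dvd n" "g dvd k" "g > 0" using n_pos by (simp_all add: g_def)
  have "z ^ (n div g) = \<zeta> ^ (n * (k div g))"
    using g by (simp add: k flip: power_mult) (metis div_mult_swap dvd_div_mult mult.commute)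
  also have "\<dots> = 1" using prim by (simp add: primitive_root_def)
  finally have "n dvd n div g" using z by (simp add: primitive_root_def)
  hence "g = 1" using g n_pos
    by (metis One_nat_def div_greater_zero_iff div_less_dividend dvd_imp_le le_neq_implies_less
        less_one linorder_not_le nat_dvd_not_less)
  thus ?thesis using that k by (simp add: g_def coprime_iff_gcd_eq_1)
qed

text \<open>The minimal polynomial divides \<open>X\<^sup>n - 1\<close>, which has \<open>n\<close> distinct roots.\<close>
lemma card_conjugates: "card conjugates = Polynomial.degree m"
proof -
  define P :: "rat poly" where "P = Polynomial.monom 1 n - 1"
  have P: "rat_eval P z = z ^ n - 1" for z by (simp add: P_def)
  have degP: "Polynomial.degree P \<le> n"
    unfolding P_def by (rule Polynomial.degree_diff_le) (simp_all add: Polynomial.degree_monom_le)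
  have "rat_eval P 0 \<noteq> 0" using n_pos by (simp add: P power_0_left)
  hence "P \<noteq> 0" by auto
  have "rat_eval P \<zeta> = 0" using prim by (simp add: P primitive_root_def)
  then obtain q where q: "P = m * q" using rat_minpoly_dvd[OF min] by blast
  have nz: "m \<noteq> 0" "q \<noteq> 0" using q \<open>P \<noteq> 0\<close> by auto
  have "{z. z ^ n = 1} = {z. rat_eval P z = 0}" by (simp add: P)
  also have "\<dots> = conjugates \<union> {z. rat_eval q z = 0}" by (auto simp: q)
  finally have "n = card (conjugates \<union> {z. rat_eval q z = 0})"
    using card_roots_unity_eq[OF n_pos] by simp
  also have "\<dots> \<le> card conjugates + card {z. rat_eval q z = 0}" by (rule card_Un_le)
  also have "\<dots> \<le> card conjugates + Polynomial.degree q" using rat_eval_roots(2)[OF nz(2)] by simp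
  finally have "Polynomial.degree P \<le> card conjugates + Polynomial.degree q" using degP by simp
  hence "Polynomial.degree m \<le> card conjugates"
    using nz by (simp add: q Polynomial.degree_mult_eq)
  thus ?thesis using rat_eval_roots(2)[OF nz(1)] by simp
qed

text \<open>After reduction modulo \<open>m\<close>, subtracting the common value leaves a
  polynomial of degree below that of \<open>m\<close> which vanishes at all conjugates. By
  \<open>card_conjugates\<close> it is zero, so the value is the constant coefficient of
  \<open>r\<close>.\<close>

lemma fixed_imp_rational:
  assumes fixed: "\<And>z. z \<in> conjugates \<Longrightarrow> rat_eval p z = rat_eval p \<zeta>"
  shows "rat_eval p \<zeta> \<in> \<rat>"
proof -
  define r where "r = p mod m"
  define P :: "complex poly" where "P = map_poly of_rat r - [:rat_eval p \<zeta>:]"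
  have r: "rat_eval r z = rat_eval p z" if "z \<in> conjugates" for z
    using that by (simp add: r_def rat_eval_mod)
  have "conjugates \<subseteq> {z. poly P z = 0}"
    using fixed r by (auto simp: P_def rat_eval_def)
  moreover have "Polynomial.degree P < Polynomial.degree m"
    using degree_mod_rat_minpoly[OF min, of p] rat_minpoly_degree_pos[OF min]
    unfolding P_def r_def by (intro Polynomial.degree_diff_less) simp_all
  ultimately have "P = 0"
    using card_poly_roots_bound[of P] poly_roots_finite[of P] card_conjugates
      card_mono[of "{z. poly P z = 0}" conjugates] by fastforce
  hence "Polynomial.coeff P 0 = 0" by simp
  hence "rat_eval p \<zeta> = of_rat (Polynomial.coeff r 0)"
    by (simp add: P_def coeff_map_poly)
  thus ?thesis by simp
qed

text \<open>Take \<open>q\<close> to be the \<open>k\<close>-th power of the variable. Then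
  \<open>m\<close> composed with \<open>q\<close> vanishes at \<open>\<zeta>\<close>, hence at every
  conjugate; this stands in for composing two automorphisms.\<close>

lemma pcompose_conjugate:
  assumes "z \<in> conjugates"
  obtains q where "z = rat_eval q \<zeta>" "\<And>z'. z' \<in> conjugates \<Longrightarrow> rat_eval q z' \<in> conjugates"
proof -
  obtain k where k: "z = \<zeta> ^ k" using conjugate_power[OF assms] by blast
  define q :: "rat poly" where "q = [:0, 1:] ^ k"
  have "rat_eval q z' \<in> conjugates" if "z' \<in> conjugates" for z'
  proof -
    have "rat_eval (pcompose m q) \<zeta> = rat_eval 0 \<zeta>"
      using assms by (simp add: q_def k)
    hence "rat_eval (pcompose m q) z' = rat_eval 0 z'"
      using eval_conjugate_iff[OF that] by blast
    thus ?thesis by simp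
  qed
  thus ?thesis using that[of q] by (simp add: q_def k)
qed

section \<open>Orbit polynomials and the trace as an orbit sum\<close>

definition orbit :: "rat poly \<Rightarrow> complex set" where
  "orbit p = rat_eval p ` conjugates"

lemma finite_orbit: "finite (orbit p)"
  by (simp add: orbit_def finite_conjugates)

text \<open>The polynomials \<open>c i\<close> do not depend on \<open>z\<close>, so the
  coefficients of the product have the form to which \<open>fixed_imp_rational\<close>
  applies.\<close>

lemma coeff_prod_linear_eval:
  assumes "finite A"
  shows "\<exists>c :: nat \<Rightarrow> rat poly. \<forall>z i.
    Polynomial.coeff (\<Prod>b\<in>A. [:- rat_eval (g b) z, 1:]) i = rat_eval (c i) z"
  using assms
proof (induction A rule: finite_induct)
  case empty
  show ?case by (intro exI[of _ "\<lambda>i. if i = 0 then 1 else 0"]) simp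
next
  case (insert b A)
  then obtain c where c: "Polynomial.coeff (\<Prod>b\<in>A. [:- rat_eval (g b) z, 1:]) i = rat_eval (c i) z"
    for z i by blast
  show ?case
    by (rule exI[of _ "\<lambda>i. (case i of 0 \<Rightarrow> 0 | Suc j \<Rightarrow> c j) - g b * c i"])
       (use insert.hyps in \<open>simp add: c coeff_pCons split: nat.split\<close>)
qed

text \<open>Replacing \<open>\<zeta>\<close> by a conjugate permutes the factors of the product, so its coefficients are
  fixed.\<close>
lemma orbit_poly_rational:
  "Polynomial.coeff (\<Prod>b\<in>orbit p. [:- b, 1:]) i \<in> \<rat>"
proof -
  \<comment> \<open>Each orbit element is rewritten as a polynomial in \<open>\<zeta>\<close>
    itself, by composing \<open>p\<close> with the power that yields its conjugate, so that
    \<open>\<zeta>\<close> can be replaced simultaneously in all factors.\<close>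
  have "\<exists>g. b = rat_eval g \<zeta> \<and> (\<forall>z\<in>conjugates. rat_eval g z \<in> orbit p)" if b: "b \<in> orbit p" for b
  proof -
    from b obtain z where z: "z \<in> conjugates" "b = rat_eval p z" by (auto simp: orbit_def)
    obtain q where q: "z = rat_eval q \<zeta>" "\<And>z'. z' \<in> conjugates \<Longrightarrow> rat_eval q z' \<in> conjugates"
      using pcompose_conjugate[OF z(1)] by blast
    show ?thesis
      by (rule exI[of _ "pcompose p q"]) (use z q in \<open>auto simp: orbit_def\<close>)
  qed
  then obtain g where g: "\<And>b. b \<in> orbit p \<Longrightarrow> b = rat_eval (g b) \<zeta>"
      "\<And>b z. b \<in> orbit p \<Longrightarrow> z \<in> conjugates \<Longrightarrow> rat_eval (g b) z \<in> orbit p"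
    by metis
  obtain c where c: "\<And>z i. Polynomial.coeff (\<Prod>b\<in>orbit p. [:- rat_eval (g b) z, 1:]) i = rat_eval (c i) z"
    using coeff_prod_linear_eval[OF finite_orbit] by blast
  have perm: "(\<Prod>b\<in>orbit p. [:- rat_eval (g b) z, 1:]) = (\<Prod>b\<in>orbit p. [:- b, 1:])"
    if z: "z \<in> conjugates" for z
  proof -
    \<comment> \<open>An injective self-map of a finite set is a permutation, so the product over
      the orbit is unchanged.\<close>
    have inj: "inj_on (\<lambda>b. rat_eval (g b) z) (orbit p)"
      by (rule inj_onI) (metis eval_conjugate_iff[OF z] g(1))
    have "(\<lambda>b. rat_eval (g b) z) ` orbit p = orbit p"
      by (rule endo_inj_surj[OF finite_orbit _ inj]) (use g(2) z in blast)
    thus ?thesis using prod.reindex[OF inj, of "\<lambda>b. [:- b, 1:]"] by simp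
  qed
  have "rat_eval (c i) z = rat_eval (c i) \<zeta>" if "z \<in> conjugates" for z
    using perm[OF that] perm[OF self_conjugate] by (simp flip: c)
  hence "rat_eval (c i) \<zeta> \<in> \<rat>" by (rule fixed_imp_rational)
  thus ?thesis using perm[OF self_conjugate] by (simp flip: c)
qed

lemma orbit_annihilated:
  assumes "rat_eval q (rat_eval p \<zeta>) = 0" "b \<in> orbit p"
  shows "rat_eval q b = 0"
proof -
  from assms obtain z where z: "z \<in> conjugates" "b = rat_eval p z" by (auto simp: orbit_def)
  have "rat_eval (pcompose q p) \<zeta> = rat_eval 0 \<zeta>" using assms by simp
  hence "rat_eval (pcompose q p) z = rat_eval 0 z" using eval_conjugate_iff[OF z(1)] by blast
  thus ?thesis using z by simp
qed

text \<open>The product \<open>F\<close> over the orbit descends to a rational polynomial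
  \<open>f\<close>. It is minimal because any rational polynomial killing one orbit element kills
  all of them, and \<open>f\<close> has degree equal to their number. The trace is then read off by
  Vieta.\<close>

lemma orbit_trace:
  "of_rat (field_trace (rat_adjoin (rat_eval p \<zeta>)) (rat_eval p \<zeta>)) = \<Sum>(orbit p)"
proof -
  let ?a = "rat_eval p \<zeta>"
  have fin: "finite (orbit p)" by (rule finite_orbit)
  have mem: "?a \<in> orbit p" using self_conjugate by (auto simp: orbit_def)
  define F where "F = (\<Prod>b\<in>orbit p. [:- b, 1:])"
  \<comment> \<open>The case for zero guarantees that the coefficient map sends 0 to 0, as
    \<open>coeff_map_poly\<close> requires.\<close>
  define f :: "rat poly" where "f = map_poly (\<lambda>z. if z = 0 then 0 else SOME q. of_rat q = z) F"
  have "of_rat (Polynomial.coeff f i) = Polynomial.coeff F i" for i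
    using orbit_poly_rational[of p i] someI[of "\<lambda>q. of_rat q = Polynomial.coeff F i"]
    by (auto simp: f_def coeff_map_poly F_def[symmetric] elim!: Rats_cases)
  hence f: "map_poly of_rat f = F" by (intro poly_eqI) (simp add: coeff_map_poly)
  have deg: "Polynomial.degree f = card (orbit p)"
    using coeff_prod_linear(1)[OF fin] by (simp flip: degree_map_of_rat add: f F_def)
  have coeff: "of_rat (Polynomial.coeff f i) = Polynomial.coeff F i" for i
    by (simp flip: f add: coeff_map_poly)
  have lead: "Polynomial.lead_coeff f = 1"
    using coeff[of "card (orbit p)"] coeff_prod_linear(2)[OF fin] by (simp add: deg F_def)
  have min: "rat_minpoly f ?a"
    unfolding rat_minpoly_def
  proof (intro conjI allI impI)
    show "f \<noteq> 0" using lead by auto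
    show "rat_eval f ?a = 0"
      using mem fin by (auto simp: rat_eval_def f F_def poly_prod)
    fix q assume q: "q \<noteq> 0" "rat_eval q ?a = 0"
    have "orbit p \<subseteq> {z. rat_eval q z = 0}" using orbit_annihilated[OF q(2)] by blast
    from card_mono[OF rat_eval_roots(1)[OF q(1)] this] rat_eval_roots(2)[OF q(1)]
    show "Polynomial.degree f \<le> Polynomial.degree q" unfolding deg by (rule order_trans)
  qed
  have "of_rat (field_trace (rat_adjoin ?a) ?a) = - Polynomial.coeff F (card (orbit p) - 1)"
    by (subst field_trace_rat_adjoin[OF min lead]) (simp add: of_rat_minus coeff deg)
  also have "\<dots> = \<Sum>(orbit p)"
    using coeff_prod_linear(3)[OF fin] mem unfolding F_def
    by (metis empty_iff minus_minus)
  finally show ?thesis .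
qed

section \<open>Automorphisms of the cyclotomic field\<close>

lemma rat_adjoin_zeta: "rat_adjoin \<zeta> = range (\<lambda>p. rat_eval p \<zeta>)"
  by (rule rat_adjoin_eq[OF min])

text \<open>The substitution maps the field into itself because \<open>z\<close> is a power of
  \<open>\<zeta>\<close>, and onto it because \<open>\<zeta>\<close> is in turn a power of
  \<open>z\<close>.\<close>

lemma conjugate_automorphism:
  assumes z: "z \<in> conjugates" and K: "K = (ring_of_type_algebra :: complex ring)\<lparr>carrier := rat_adjoin \<zeta>\<rparr>"
  obtains \<sigma> where "\<sigma> \<in> ring_iso K K" "\<And>p. \<sigma> (rat_eval p \<zeta>) = rat_eval p z"
proof -
  \<comment> \<open>The choice of \<open>p\<close> does not matter, by
    \<open>eval_conjugate_iff\<close>.\<close>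
  define \<sigma> where "\<sigma> x = rat_eval (SOME p. x = rat_eval p \<zeta>) z" for x
  have \<sigma>: "\<sigma> (rat_eval p \<zeta>) = rat_eval p z" for p
    using someI[of "\<lambda>q. rat_eval p \<zeta> = rat_eval q \<zeta>" p] eval_conjugate_iff[OF z]
    unfolding \<sigma>_def by metis
  obtain k where k: "z = \<zeta> ^ k" using conjugate_power[OF z] by blast
  have "\<zeta> \<in> {w. w ^ n = 1}" using prim by (simp add: primitive_root_def)
  then obtain j where j: "\<zeta> = z ^ j"
    using primitive_root_image[OF conjugate_primitive[OF z]] by blast
  have "\<sigma> \<in> ring_iso K K"
  proof (rule ring_iso_memI)
    fix x assume "x \<in> carrier K"
    then obtain p where p: "x = rat_eval p \<zeta>" by (auto simp: K rat_adjoin_zeta)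
    have "\<sigma> x = rat_eval (pcompose p ([:0, 1:] ^ k)) \<zeta>" by (simp add: p \<sigma> k)
    hence "\<sigma> x \<in> rat_adjoin \<zeta>" unfolding rat_adjoin_zeta by blast
    thus "\<sigma> x \<in> carrier K" by (simp add: K)
    fix y assume "y \<in> carrier K"
    then obtain q where q: "y = rat_eval q \<zeta>" by (auto simp: K rat_adjoin_zeta)
    show "\<sigma> (x \<otimes>\<^bsub>K\<^esub> y) = \<sigma> x \<otimes>\<^bsub>K\<^esub> \<sigma> y"
      using \<sigma>[of "p * q"] by (simp add: K p q \<sigma>)
    show "\<sigma> (x \<oplus>\<^bsub>K\<^esub> y) = \<sigma> x \<oplus>\<^bsub>K\<^esub> \<sigma> y"
      using \<sigma>[of "p + q"] by (simp add: K p q \<sigma>)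
  next
    show "\<sigma> \<one>\<^bsub>K\<^esub> = \<one>\<^bsub>K\<^esub>" using \<sigma>[of 1] by (simp add: K)
    show "bij_betw \<sigma> (carrier K) (carrier K)"
      unfolding bij_betw_def
    proof
      show "inj_on \<sigma> (carrier K)"
        by (rule inj_onI) (auto simp: K rat_adjoin_zeta \<sigma> eval_conjugate_iff[OF z])
      show "\<sigma> ` carrier K = carrier K"
      proof (intro equalityI subsetI)
        fix y assume "y \<in> \<sigma> ` carrier K"
        then obtain p where p: "y = rat_eval p z" by (auto simp: K rat_adjoin_zeta \<sigma>)
        have "y = rat_eval (pcompose p ([:0, 1:] ^ k)) \<zeta>" by (simp add: p k)
        hence "y \<in> rat_adjoin \<zeta>" unfolding rat_adjoin_zeta by blast
        thus "y \<in> carrier K" by (simp add: K)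
      next
        fix y assume "y \<in> carrier K"
        then obtain p where p: "y = rat_eval p \<zeta>" by (auto simp: K rat_adjoin_zeta)
        have "\<sigma> (rat_eval (pcompose p ([:0, 1:] ^ j)) \<zeta>) = rat_eval p (z ^ j)"
          unfolding \<sigma> by simp
        also have "\<dots> = y" using p j by simp
        finally have "y \<in> \<sigma> ` rat_adjoin \<zeta>" unfolding rat_adjoin_zeta by blast
        thus "y \<in> \<sigma> ` carrier K" by (simp add: K)
      qed
    qed
  qed
  thus ?thesis using that \<sigma> by blast
qed

text \<open>A ring automorphism fixes 1, hence naturals, integers and fractions; so it commutes with
  evaluating rational polynomials.\<close>

lemma automorphism_rat_eval:
  assumes \<sigma>: "\<sigma> \<in> ring_iso K K"
    and K: "K = (ring_of_type_algebra :: complex ring)\<lparr>carrier := rat_adjoin \<zeta>\<rparr>"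
  shows "\<sigma> (rat_eval p \<zeta>) = rat_eval p (\<sigma> \<zeta>)"
proof -
  have closed: "rat_eval p \<zeta> \<in> carrier K" for p by (auto simp: K rat_adjoin_zeta)
  have add: "\<sigma> (x + y) = \<sigma> x + \<sigma> y" if "x \<in> carrier K" "y \<in> carrier K" for x y
    using ring_iso_memE(3)[OF \<sigma> that] by (simp add: K)
  have mult: "\<sigma> (x * y) = \<sigma> x * \<sigma> y" if "x \<in> carrier K" "y \<in> carrier K" for x y
    using ring_iso_memE(2)[OF \<sigma> that] by (simp add: K)
  have one: "\<sigma> 1 = 1" using ring_iso_memE(4)[OF \<sigma>] by (simp add: K)
  have rat: "of_rat q \<in> carrier K" for q using closed[of "[:q:]"] by simp
  have nat_closed: "of_nat k \<in> carrier K" for k using rat[of "of_nat k"] by simp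
  have zero: "\<sigma> 0 = 0" using add[of 0 0] nat_closed[of 0] by simp
  have nat: "\<sigma> (of_nat k) = of_nat k" for k
  proof (induction k)
    case (Suc k)
    thus ?case using add[of 1 "of_nat k"] nat_closed[of 1] nat_closed[of k] one by simp
  qed (simp add: zero)
  have int_closed: "of_int k \<in> carrier K" for k using rat[of "of_int k"] by simp
  have int: "\<sigma> (of_int k) = of_int k" for k
  proof (cases k rule: int_cases2)
    case (nonpos i)
    have "\<sigma> (- of_nat i) + \<sigma> (of_nat i) = 0"
      using add[of "- of_nat i" "of_nat i"] int_closed[of "- int i"] nat_closed[of i] zero by simp
    thus ?thesis using nonpos nat[of i] by (simp add: add_eq_0_iff2)
  qed (simp add: nat)
  have rational: "\<sigma> (of_rat q) = of_rat q" for q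
  proof -
    obtain a b where q: "q = Rat.Fract a b" "b > 0" by (cases q)
    hence eq: "of_rat q * of_int b = (of_int a :: complex)" by (simp add: of_rat_rat)
    have "\<sigma> (of_rat q) * of_int b = \<sigma> (of_rat q * of_int b)"
      using mult[OF rat int_closed] int by simp
    also have "\<dots> = of_rat q * of_int b" unfolding eq by (rule int)
    finally show ?thesis using q by simp
  qed
  have \<zeta>: "\<zeta> \<in> carrier K" using closed[of "[:0, 1:]"] by simp
  have mult_closed: "\<zeta> * rat_eval p \<zeta> \<in> carrier K" for p using closed[of "pCons 0 p"] by simp
  show ?thesis
    by (induction p) (simp_all add: zero add[OF rat mult_closed] mult[OF \<zeta> closed] rational)
qed

text \<open>An automorphism sends \<open>\<zeta>\<close> to a root of \<open>m\<close>, since it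
  commutes with evaluating \<open>m\<close>; conversely every root comes from
  \<open>conjugate_automorphism\<close>.\<close>

lemma galois_conj_iff:
  assumes "\<zeta> = cis (2 * pi / of_nat n)"
  shows "galois_conj n (rat_eval p \<zeta>) b \<longleftrightarrow> b \<in> orbit p"
proof -
  define K where "K = (ring_of_type_algebra :: complex ring)\<lparr>carrier := rat_adjoin \<zeta>\<rparr>"
  have K: "cyclotomic_field n = K" by (simp add: cyclotomic_field_def K_def assms)
  show ?thesis
  proof
    assume "galois_conj n (rat_eval p \<zeta>) b"
    then obtain \<sigma> where \<sigma>: "\<sigma> \<in> ring_iso K K" "\<sigma> (rat_eval p \<zeta>) = b"
      by (auto simp: galois_conj_def K)
    have eval: "\<sigma> (rat_eval q \<zeta>) = rat_eval q (\<sigma> \<zeta>)" for q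
      by (rule automorphism_rat_eval[OF \<sigma>(1) K_def])
    have "rat_eval m (\<sigma> \<zeta>) = 0" using eval[of m] eval[of 0] self_conjugate by simp
    thus "b \<in> orbit p" using eval[of p] \<sigma>(2) by (auto simp: orbit_def)
  next
    assume "b \<in> orbit p"
    then obtain z where z: "z \<in> conjugates" "b = rat_eval p z" by (auto simp: orbit_def)
    obtain \<sigma> where "\<sigma> \<in> ring_iso K K" "\<And>p. \<sigma> (rat_eval p \<zeta>) = rat_eval p z"
      using conjugate_automorphism[OF z(1) K_def] by blast
    thus "galois_conj n (rat_eval p \<zeta>) b" by (auto simp: galois_conj_def K z)
  qed
qed

end

lemma cyclotomic_exists:
  assumes "n > 0"
  obtains m where "cyclotomic n (cis (2 * pi / of_nat n)) m"
proof -
  let ?\<zeta> = "cis (2 * pi / of_nat n)"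
  have prim: "primitive_root n ?\<zeta>" by (rule primitive_root_cis[OF assms])
  define P :: "rat poly" where "P = Polynomial.monom 1 n - 1"
  have P: "rat_eval P z = z ^ n - 1" for z by (simp add: P_def)
  have "rat_eval P 0 \<noteq> 0" using assms by (simp add: P power_0_left)
  hence "P \<noteq> 0" by auto
  moreover have "rat_eval P ?\<zeta> = 0" using prim by (simp only: P primitive_root_def) simp
  ultimately obtain m where "rat_minpoly m ?\<zeta>" by (rule rat_minpoly_exists)
  with prim show ?thesis using that by (simp add: cyclotomic_def)
qed

section \<open>Character values\<close>

lemma mat_trace_commute:
  assumes A: "A \<in> carrier_mat n k" and B: "B \<in> carrier_mat k n"
  shows "mat_trace (A * B) = mat_trace (B * A)"
proof -
  have "mat_trace (A * B) = (\<Sum>i<n. \<Sum>j<k. A $$ (i, j) * B $$ (j, i))"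
    using A B by (auto simp: mat_trace_def scalar_prod_def atLeast0LessThan intro!: sum.cong)
  also have "\<dots> = (\<Sum>j<k. \<Sum>i<n. B $$ (j, i) * A $$ (i, j))"
    by (subst sum.swap) (simp add: mult.commute)
  also have "\<dots> = mat_trace (B * A)"
    using A B by (auto simp: mat_trace_def scalar_prod_def atLeast0LessThan intro!: sum.cong)
  finally show ?thesis .
qed

lemma mat_trace_similar:
  assumes "A \<in> carrier_mat n n" "similar_mat_wit A B P Q"
  shows "mat_trace A = mat_trace B"
proof -
  note w = similar_mat_witD2[OF assms]
  have "mat_trace A = mat_trace (P * (B * Q))" using w by simp
  also have "\<dots> = mat_trace ((B * Q) * P)" by (rule mat_trace_commute[of _ n n]) (use w in auto)
  also have "(B * Q) * P = B" using w by simp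
  finally show ?thesis .
qed

lemma upper_triangular_mult:
  fixes A B :: "complex mat"
  assumes A: "A \<in> carrier_mat n n" "upper_triangular A" and B: "B \<in> carrier_mat n n" "upper_triangular B"
  shows "upper_triangular (A * B)"
    and "i < n \<Longrightarrow> (A * B) $$ (i, i) = A $$ (i, i) * B $$ (i, i)"
proof -
  have entry: "(A * B) $$ (i, j) = (\<Sum>k<n. A $$ (i, k) * B $$ (k, j))" if "i < n" "j < n" for i j
    using A(1) B(1) that by (auto simp: scalar_prod_def atLeast0LessThan intro!: sum.cong)
  have zero: "A $$ (i, k) * B $$ (k, j) = 0" if "i < n" "k < n" "k < i \<or> j < k" for i j k
    using upper_triangularD[OF A(2), of k i] upper_triangularD[OF B(2), of j k] that A(1) B(1) by auto
  show "upper_triangular (A * B)"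
  proof (rule upper_triangularI)
    fix i j assume "j < i" "i < dim_row (A * B)"
    hence ij: "j < i" "i < n" "j < n" using A(1) by auto
    show "(A * B) $$ (i, j) = 0"
      unfolding entry[OF ij(2,3)]
    proof (rule sum.neutral, rule ballI)
      fix k assume "k \<in> {..<n}"
      thus "A $$ (i, k) * B $$ (k, j) = 0" using zero[of i k j] ij by (cases "k < i") auto
    qed
  qed
  assume i: "i < n"
  have "(A * B) $$ (i, i) = (\<Sum>k<n. if k = i then A $$ (i, i) * B $$ (i, i) else 0)"
    unfolding entry[OF i i] by (rule sum.cong) (use zero[OF i] in \<open>auto simp: nat_neq_iff\<close>)
  thus "(A * B) $$ (i, i) = A $$ (i, i) * B $$ (i, i)" using i by simp
qed

lemma upper_triangular_pow:
  fixes A :: "complex mat"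
  assumes A: "A \<in> carrier_mat n n" "upper_triangular A"
  shows "upper_triangular (A ^\<^sub>m k) \<and> (\<forall>i<n. (A ^\<^sub>m k) $$ (i, i) = (A $$ (i, i)) ^ k)"
proof (induction k)
  case (Suc k)
  thus ?case
    using upper_triangular_mult[OF pow_carrier_mat[OF A(1), of k] _ A] by (simp add: mult.commute)
qed (use A in simp)

text \<open>The \<open>e i\<close> are the diagonal entries of a triangular matrix similar to
  \<open>A\<close>. Powers of it stay triangular with powered diagonals, so one family serves all
  \<open>k\<close>, and the \<open>N\<close>-th power is the identity.\<close>

lemma mat_trace_pow_eigenvalues:
  assumes A: "A \<in> carrier_mat n n" and pow: "A ^\<^sub>m N = 1\<^sub>m n"
  obtains e :: "nat \<Rightarrow> complex" where "\<And>i. i < n \<Longrightarrow> e i ^ N = 1"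
    "\<And>k. mat_trace (A ^\<^sub>m k) = (\<Sum>i<n. e i ^ k)"
proof -
  obtain es where "char_poly A = (\<Prod>a\<leftarrow>es. [:- a, 1:])" using char_poly_factorized[OF A] by blast
  then obtain B where B: "B \<in> carrier_mat n n" "upper_triangular B" "similar_mat A B"
    using schur_decomposition_exists[OF A] by blast
  then obtain P Q where wit: "similar_mat_wit A B P Q" by (auto simp: similar_mat_def)
  have wit_pow: "similar_mat_wit (A ^\<^sub>m k) (B ^\<^sub>m k) P Q" for k by (rule similar_mat_wit_pow[OF wit])
  have tr: "mat_trace (A ^\<^sub>m k) = (\<Sum>i<n. (B $$ (i, i)) ^ k)" for k
    using mat_trace_similar[OF pow_carrier_mat[OF A] wit_pow] upper_triangular_pow[OF B(1,2), of k]
      pow_carrier_mat[OF B(1), of k] carrier_matD(1)[OF B(1)]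
    by (simp add: mat_trace_def)
  have "B ^\<^sub>m N = Q * A ^\<^sub>m N * P"
    using similar_mat_witD2(3)[OF pow_carrier_mat[OF B(1)] similar_mat_wit_sym[OF wit_pow[of N]]] .
  also have "\<dots> = 1\<^sub>m n"
    unfolding pow using similar_mat_witD2(2,6,7)[OF A wit] by simp
  finally have "(B $$ (i, i)) ^ N = 1" if "i < n" for i
    using upper_triangular_pow[OF B(1,2), of N] that by (metis index_one_mat(1))
  thus ?thesis using that[of "\<lambda>i. B $$ (i, i)"] tr by blast
qed

lemma GL_hom_simps:
  assumes "\<rho> \<in> hom G (GL n)"
  shows "x \<in> carrier G \<Longrightarrow> \<rho> x \<in> carrier_mat n n"
    and "x \<in> carrier G \<Longrightarrow> y \<in> carrier G \<Longrightarrow> \<rho> (x \<otimes>\<^bsub>G\<^esub> y) = \<rho> x * \<rho> y"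
  using assms
  by (auto simp: hom_def GL_def units_of_def Units_def ring_mat_def Pi_iff)

lemma (in group) GL_hom_one:
  assumes \<rho>: "\<rho> \<in> hom G (GL n)"
  shows "\<rho> \<one> = 1\<^sub>m n"
proof -
  interpret R: Ring.ring "ring_mat TYPE(complex) n ()" by (rule ring_mat)
  have "group (GL n)" unfolding GL_def by (rule R.units_group)
  hence "\<rho> \<one> = \<one>\<^bsub>GL n\<^esub>" using \<rho> hom_one[OF \<rho> is_group] by blast
  thus ?thesis by (simp add: GL_def units_of_def ring_mat_def)
qed

lemma (in group) GL_hom_pow:
  assumes \<rho>: "\<rho> \<in> hom G (GL n)" and x: "x \<in> carrier G"
  shows "\<rho> (x [^] (k::nat)) = \<rho> x ^\<^sub>m k"
  using x GL_hom_simps[OF \<rho>] carrier_matD(1)[OF GL_hom_simps(1)[OF \<rho> x]]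
  by (induction k) (simp_all add: GL_hom_one[OF \<rho>])

lemma IrrE:
  assumes "\<chi> \<in> Irr G"
  obtains n \<rho> where "\<rho> \<in> hom G (GL n)" "\<And>g. g \<in> carrier G \<Longrightarrow> \<chi> g = mat_trace (\<rho> g)"
  using assms by (auto simp: Irr_def irreducible_rep_def)

text \<open>Writing the eigenvalues as powers \<open>w ^ t i\<close>, the sum of the monomials with
  exponents \<open>t i\<close> is a polynomial that works for every \<open>k\<close> at once.
  Raising \<open>x\<close> to a power thus corresponds to a substitution for
  \<open>w\<close>.\<close>

lemma (in group) character_power_values:
  assumes \<chi>: "\<chi> \<in> Irr G" and w: "primitive_root (Coset.order G) w"
    and x: "x \<in> carrier G"
  obtains p where "\<And>k::nat. \<chi> (x [^] k) = rat_eval p (w ^ k)"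
proof -
  obtain n \<rho> where \<rho>: "\<rho> \<in> hom G (GL n)" "\<And>g. g \<in> carrier G \<Longrightarrow> \<chi> g = mat_trace (\<rho> g)"
    using IrrE[OF \<chi>] by blast
  have "\<rho> x ^\<^sub>m Coset.order G = 1\<^sub>m n"
    using GL_hom_pow[OF \<rho>(1) x] pow_order_eq_1[OF x] GL_hom_one[OF \<rho>(1)] by metis
  from mat_trace_pow_eigenvalues[OF GL_hom_simps(1)[OF \<rho>(1) x] this]
  obtain e where e: "\<And>i. i < n \<Longrightarrow> e i ^ Coset.order G = 1"
      "\<And>k. mat_trace (\<rho> x ^\<^sub>m k) = (\<Sum>i<n. e i ^ k)" by blast
  have "\<exists>t. e i = w ^ t" if "i < n" for i
    using primitive_root_image[OF w] e(1)[OF that] by blast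
  then obtain t where t: "\<And>i. i < n \<Longrightarrow> e i = w ^ t i" by metis
  have "\<chi> (x [^] k) = rat_eval (\<Sum>i<n. Polynomial.monom 1 (t i)) (w ^ k)" for k :: nat
    using x by (simp add: \<rho>(2) GL_hom_pow[OF \<rho>(1) x] e(2) t mult.commute flip: power_mult)
  thus ?thesis by (rule that)
qed

text \<open>The value at the identity is the trace of an identity matrix, so \<open>n = 1\<close>,
  and the trace of a 1 by 1 matrix is its entry.\<close>

lemma (in group) linear_char_mult:
  assumes \<chi>: "\<chi> \<in> Irr G" "linear_char G \<chi>" and xy: "x \<in> carrier G" "y \<in> carrier G"
  shows "\<chi> (x \<otimes> y) = \<chi> x * \<chi> y"
proof -
  obtain n \<rho> where \<rho>: "\<rho> \<in> hom G (GL n)" "\<And>g. g \<in> carrier G \<Longrightarrow> \<chi> g = mat_trace (\<rho> g)"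
    using IrrE[OF \<chi>(1)] by blast
  have "of_nat n = (1::complex)"
    using \<chi>(2) \<rho>(2)[OF one_closed] by (simp add: linear_char_def GL_hom_one[OF \<rho>(1)] mat_trace_def)
  hence "n = 1" by simp
  thus ?thesis
    using xy GL_hom_simps[OF \<rho>(1)] \<rho>(2) carrier_matD[OF GL_hom_simps(1)[OF \<rho>(1) xy(1)]]
      carrier_matD[OF GL_hom_simps(1)[OF \<rho>(1) xy(2)]]
    by (simp add: mat_trace_def scalar_prod_def)
qed

section \<open>Power maps with exponent prime to the group order\<close>

lemma (in group) pow_mod_order:
  assumes "x \<in> carrier G"
  shows "x [^] (k mod Coset.order G) = x [^] (k::nat)"
proof -
  let ?N = "Coset.order G"
  have "x [^] k = x [^] (?N * (k div ?N) + k mod ?N)" by simp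
  also have "\<dots> = (x [^] ?N) [^] (k div ?N) \<otimes> x [^] (k mod ?N)"
    using assms by (simp only: nat_pow_mult nat_pow_pow)
  also have "\<dots> = x [^] (k mod ?N)"
    using assms by (simp add: pow_order_eq_1[OF assms])
  finally show ?thesis by simp
qed

text \<open>An inverse \<open>j\<close> of \<open>k\<close> modulo the group order undoes the power
  map.\<close>

lemma (in group) coprime_pow_bij:
  assumes fin: "finite (carrier G)" and k: "coprime k (Coset.order G)"
  shows "bij_betw (\<lambda>x. x [^] (k::nat)) (carrier G) (carrier G)"
proof -
  obtain j where "[k * j = Suc 0] (mod Coset.order G)"
    using cong_solve_coprime_nat[OF k] by auto
  hence inv: "(x [^] k) [^] j = x" if "x \<in> carrier G" for x
    using pow_mod_order[OF that, of "k * j"] pow_mod_order[OF that, of "Suc 0"] that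
    by (simp add: nat_pow_pow Cong.cong_def)
  have "inj_on (\<lambda>x. x [^] k) (carrier G)" by (rule inj_on_inverseI) (rule inv)
  moreover have "(\<lambda>x. x [^] k) ` carrier G \<subseteq> carrier G" by auto
  ultimately show ?thesis using endo_inj_surj[OF fin] by (auto simp: bij_betw_def)
qed

text \<open>The power map carries one fibre onto the other and, \<open>k\<close> being prime to
  every element order, preserves orders. It serves both the Galois orbits and the cosets of a
  kernel.\<close>

lemma (in group) psi_value_fibre_power:
  assumes fin: "finite (carrier G)" and k: "coprime k (Coset.order G)"
    and conj: "\<And>x. x \<in> carrier G \<Longrightarrow> \<chi> (x [^] k) = b \<longleftrightarrow> \<chi> x = a"
  shows "psi G (value_fibre G \<chi> b) = psi G (value_fibre G \<chi> a)"
proof -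
  let ?f = "\<lambda>x. x [^] k"
  have bij: "bij_betw ?f (carrier G) (carrier G)" by (rule coprime_pow_bij[OF fin k])
  have inj: "inj_on ?f (value_fibre G \<chi> a)"
    by (rule inj_on_subset[OF bij_betw_imp_inj_on[OF bij]]) (auto simp: value_fibre_def)
  have "value_fibre G \<chi> b = ?f ` value_fibre G \<chi> a"
  proof (intro equalityI subsetI)
    fix y assume y: "y \<in> value_fibre G \<chi> b"
    then obtain x where x: "x \<in> carrier G" "y = x [^] k"
      using bij_betw_imp_surj_on[OF bij] by (auto simp: value_fibre_def)
    hence "\<chi> x = a" using conj[OF x(1)] y by (simp add: value_fibre_def)
    thus "y \<in> ?f ` value_fibre G \<chi> a" using x by (simp add: value_fibre_def)
  qed (auto simp: value_fibre_def conj)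
  hence "psi G (value_fibre G \<chi> b) = (\<Sum>x\<in>value_fibre G \<chi> a. ord (?f x))"
    by (simp add: psi_def sum.reindex[OF inj])
  also have "\<dots> = psi G (value_fibre G \<chi> a)"
    unfolding psi_def
  proof (rule sum.cong[OF refl])
    fix x assume "x \<in> value_fibre G \<chi> a"
    hence x: "x \<in> carrier G" by (simp add: value_fibre_def)
    have "coprime k (ord x)"
      using k ord_dvd_group_order[OF x] by (metis coprime_divisors dvd_refl)
    thus "ord (?f x) = ord x" using pow_ord_eq_ord_iff[OF fin x] by blast
  qed
  finally show ?thesis .
qed

section \<open>The inner product with \<open>Xi\<close>, grouped by character values\<close>

lemma (in group) char_inner_Xi:
  assumes fin: "finite (carrier G)"
  shows "char_inner G (Xi G) \<chi> = cnj (\<Sum>v\<in>\<chi> ` carrier G. v * of_nat (psi G (value_fibre G \<chi> v)))"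
proof -
  have "Coset.order G > 0" using fin order_gt_0_iff_finite by blast
  \<comment> \<open>The factor in \<open>Xi\<close> cancels the normalisation. Complex conjugation
    is then moved outside, to be removed once the sum is known to be rational.\<close>
  hence "char_inner G (Xi G) \<chi> = (\<Sum>x\<in>carrier G. of_nat (ord x) * cnj (\<chi> x))"
    by (simp add: char_inner_def Xi_def sum_distrib_left mult.assoc flip: sum_distrib_left)
  also have "\<dots> = cnj (\<Sum>x\<in>carrier G. \<chi> x * of_nat (ord x))"
    by (simp add: mult.commute)
  also have "(\<Sum>x\<in>carrier G. \<chi> x * of_nat (ord x))
      = (\<Sum>v\<in>\<chi> ` carrier G. \<Sum>x\<in>{x \<in> carrier G. \<chi> x = v}. \<chi> x * of_nat (ord x))"
    by (rule sum.image_gen[OF fin])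
  also have "\<dots> = (\<Sum>v\<in>\<chi> ` carrier G. v * of_nat (psi G (value_fibre G \<chi> v)))"
    by (intro sum.cong) (auto simp: psi_def value_fibre_def sum_distrib_left)
  finally show ?thesis .
qed

lemma (in group) char_inner_Xi_trace:
  assumes fin: "finite (carrier G)" and \<chi>: "\<chi> \<in> Irr G" and R: "galois_orbit_reps G \<chi> R"
  shows "char_inner G (Xi G) \<chi> =
    (\<Sum>\<alpha>\<in>R. of_nat (psi G (value_fibre G \<chi> \<alpha>)) * of_rat (field_trace (rat_adjoin \<alpha>) \<alpha>))"
proof -
  define N where "N = Coset.order G"
  define \<zeta> where "\<zeta> = cis (2 * pi / of_nat N)"
  have "N > 0" using fin order_gt_0_iff_finite by (simp add: N_def)
  then obtain m where "cyclotomic N \<zeta> m" unfolding \<zeta>_def by (rule cyclotomic_exists)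
  then interpret c: cyclotomic N \<zeta> m .
  define V where "V = \<chi> ` carrier G"
  define F where "F a = psi G (value_fibre G \<chi> a)" for a
  define orb where "orb a = {b. galois_conj N a b}" for a
  have powers: "\<exists>p. \<forall>k::nat. \<chi> (x [^] k) = rat_eval p (\<zeta> ^ k)" if "x \<in> carrier G" for x
    using character_power_values[OF \<chi> c.prim[unfolded N_def] that] by (metis (no_types))
  have value_at: "\<chi> x = rat_eval p \<zeta>"
    if "x \<in> carrier G" "\<forall>k::nat. \<chi> (x [^] k) = rat_eval p (\<zeta> ^ k)" for x p
    using that(2)[rule_format, of 1] that(1) by simp
  have orb_orbit: "orb (rat_eval p \<zeta>) = c.orbit p" for p
    using c.galois_conj_iff[OF \<zeta>_def] by (auto simp: orb_def)
  have trace: "of_rat (field_trace (rat_adjoin a) a) = \<Sum>(orb a)" and orb_fin: "finite (orb a)"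
    if "a \<in> V" for a
  proof -
    from that obtain x where "x \<in> carrier G" "a = \<chi> x" by (auto simp: V_def)
    then obtain p where "a = rat_eval p \<zeta>" using powers value_at by metis
    thus "of_rat (field_trace (rat_adjoin a) a) = \<Sum>(orb a)" "finite (orb a)"
      using c.orbit_trace[of p] c.finite_orbit[of p] by (simp_all add: orb_orbit)
  qed
  have conj: "b \<in> V \<and> F b = F a" if a: "a \<in> V" and b: "b \<in> orb a" for a b
  proof -
    from a obtain x where x: "x \<in> carrier G" "a = \<chi> x" by (auto simp: V_def)
    then obtain p where p: "\<forall>k::nat. \<chi> (x [^] k) = rat_eval p (\<zeta> ^ k)" using powers by blast
    have a_eq: "a = rat_eval p \<zeta>" using value_at[OF x(1) p] x(2) by simp
    from b obtain z where z: "z \<in> c.conjugates" "b = rat_eval p z"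
      unfolding a_eq orb_orbit by (auto simp: c.orbit_def)
    \<comment> \<open>The conjugate value \<open>b\<close> is the character value at the
      \<open>k\<close>-th power of \<open>x\<close>; this puts \<open>b\<close> in \<open>V\<close>
      and supplies the exponent for comparing the fibres.\<close>
    obtain k where k: "coprime k N" "z = \<zeta> ^ k" using c.conjugate_power[OF z(1)] by blast
    have "b = \<chi> (x [^] k)" using p z k by simp
    hence "b \<in> V" using x by (auto simp: V_def)
    moreover have "F b = F a"
      unfolding F_def
    proof (rule psi_value_fibre_power[OF fin])
      show "coprime k (Coset.order G)" using k by (simp add: N_def)
      fix y assume y: "y \<in> carrier G"
      then obtain q where q: "\<forall>k::nat. \<chi> (y [^] k) = rat_eval q (\<zeta> ^ k)" using powers by blast
      show "\<chi> (y [^] k) = b \<longleftrightarrow> \<chi> y = a"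
        using c.eval_conjugate_iff[OF z(1), of q p] q z(2) k(2) a_eq value_at[OF y q] by simp
    qed
    ultimately show ?thesis ..
  qed
  have RV: "R \<subseteq> V" using R by (simp add: galois_orbit_reps_def V_def)
  have ex1: "\<exists>!a. a \<in> R \<and> b \<in> orb a" if "b \<in> V" for b
    using R that unfolding galois_orbit_reps_def V_def orb_def N_def mem_Collect_eq by blast
  have V_eq: "V = (\<Union>a\<in>R. orb a)"
  proof (intro equalityI subsetI)
    fix b assume "b \<in> V"
    thus "b \<in> (\<Union>a\<in>R. orb a)" using ex1 by blast
  next
    fix b assume "b \<in> (\<Union>a\<in>R. orb a)"
    thus "b \<in> V" using conj RV by blast
  qed
  \<comment> \<open>A common element of two orbits would be a character value with two
    representatives.\<close>
  have disj: "\<forall>a\<in>R. \<forall>a'\<in>R. a \<noteq> a' \<longrightarrow> orb a \<inter> orb a' = {}"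
    using ex1 conj RV by blast
  have finR: "finite R" using RV fin by (auto simp: V_def intro: finite_subset)
  have "(\<Sum>v\<in>V. v * of_nat (F v)) = (\<Sum>a\<in>R. \<Sum>v\<in>orb a. v * of_nat (F v))"
    unfolding V_eq by (rule sum.UNION_disjoint[OF finR _ disj]) (use RV orb_fin in blast)
  also have "\<dots> = (\<Sum>a\<in>R. of_nat (F a) * of_rat (field_trace (rat_adjoin a) a))"
  proof (rule sum.cong[OF refl])
    fix a assume "a \<in> R"
    hence a: "a \<in> V" using RV by blast
    have "(\<Sum>v\<in>orb a. v * of_nat (F v)) = (\<Sum>v\<in>orb a. of_nat (F a) * v)"
      by (rule sum.cong) (use conj[OF a] in \<open>auto simp: mult.commute\<close>)
    thus "(\<Sum>v\<in>orb a. v * of_nat (F v)) = of_nat (F a) * of_rat (field_trace (rat_adjoin a) a)"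
      by (simp add: trace[OF a] sum_distrib_left)
  qed
  finally have "char_inner G (Xi G) \<chi>
      = cnj (\<Sum>a\<in>R. of_nat (F a) * of_rat (field_trace (rat_adjoin a) a))"
    using char_inner_Xi[OF fin, of \<chi>] by (simp add: V_def F_def)
  moreover have "cnj (of_rat q) = of_rat q" for q
    by (cases q) (simp add: of_rat_rat)
  ultimately show ?thesis by (simp add: F_def)
qed

lemma (in group) char_inner_Xi_linear:
  assumes fin: "finite (carrier G)" and lam: "lam \<in> Irr G" "linear_char G lam"
    and K: "K = char_ker G lam" and m: "m = card (rcosets K)"
    and g: "g \<in> carrier G" and gen: "generate (G Mod K) {g <# K} = carrier (G Mod K)"
  shows "char_inner G (Xi G) lam =
    (\<Sum>d | d dvd m. of_nat (psi G ((g [^] d) <# K)) * of_int (moebius_mu (m div d)))"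
proof -
  define N where "N = Coset.order G"
  define w where "w = lam g"
  have N: "N > 0" using fin order_gt_0_iff_finite by (simp add: N_def)
  have mult: "lam (x \<otimes> y) = lam x * lam y" if "x \<in> carrier G" "y \<in> carrier G" for x y
    by (rule linear_char_mult[OF lam that])
  have one: "lam \<one> = 1" using lam(2) by (simp add: linear_char_def)
  have pow: "lam (x [^] k) = lam x ^ k" if "x \<in> carrier G" for x and k :: nat
    using that by (induction k) (simp_all add: one mult)
  have powN: "lam x ^ N = 1" if "x \<in> carrier G" for x
    using pow[OF that, of N] pow_order_eq_1[OF that] by (simp add: N_def one)
  have nz: "lam x \<noteq> 0" if "x \<in> carrier G" for x
    using powN[OF that] N by (auto simp: power_0_left)
  have inv: "lam (inv x) = inverse (lam x)" if "x \<in> carrier G" for x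
    using inverse_unique[of "lam x" "lam (inv x)"] mult[of x "inv x"] that by (simp add: one)
  have inK: "x \<in> K \<longleftrightarrow> x \<in> carrier G \<and> lam x = 1" for x by (simp add: K char_ker_def one)
  have "\<one> \<in> K" by (simp add: inK one)
  have "K \<lhd> G"
  proof (rule normal_invI)
    show "subgroup K G" 
    proof (rule subgroupI)
      show "K \<noteq> {}" using \<open>\<one> \<in> K\<close> by blast
    qed (auto simp: inK mult inv)
    show "\<And>x h. x \<in> carrier G \<Longrightarrow> h \<in> K \<Longrightarrow> x \<otimes> h \<otimes> inv x \<in> K"
      by (auto simp: inK mult inv nz)
  qed
  then interpret K: normal K G .
  \<comment> \<open>Cosets of the kernel are fibres of \<open>lam\<close>, so coset sums of orders
    become the fibre sums in \<open>char_inner_Xi\<close>.\<close>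
  have coset_eq: "K #> x = value_fibre G lam (lam x)" if x: "x \<in> carrier G" for x
  proof (intro equalityI subsetI)
    fix y assume "y \<in> K #> x"
    thus "y \<in> value_fibre G lam (lam x)" using x by (auto simp: r_coset_def value_fibre_def inK mult)
  next
    fix y assume "y \<in> value_fibre G lam (lam x)"
    hence y: "y \<in> carrier G" "lam y = lam x" by (auto simp: value_fibre_def)
    hence "y \<otimes> inv x \<in> K" using x by (simp add: inK mult inv nz)
    moreover have "y = (y \<otimes> inv x) \<otimes> x" using x y by (simp add: m_assoc)
    ultimately show "y \<in> K #> x" by (auto simp: r_coset_def)
  qed
  have lcoset_eq: "x <# K = value_fibre G lam (lam x)" if "x \<in> carrier G" for x
    using K.coset_eq coset_eq that by auto
  define V where "V = lam ` carrier G"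
  have finV: "finite V" using fin by (simp add: V_def)
  have cardV: "card V = m"
  proof -
    have "rcosets K = value_fibre G lam ` V"
      by (auto simp: RCOSETS_def coset_eq V_def)
    moreover have "inj_on (value_fibre G lam) V"
      by (rule inj_onI) (auto simp: V_def value_fibre_def)
    ultimately show ?thesis by (simp add: m card_image)
  qed
  \<comment> \<open>Induction over the generated subgroup translates the generator hypothesis:
    \<open>lam\<close> is constant on each coset, with a power of \<open>w\<close> as value. Natural
    exponents suffice, as \<open>w ^ (N - 1)\<close> is the inverse of \<open>w\<close>.\<close>
  have gen_pow: "\<exists>i::nat. \<forall>y\<in>C. lam y = w ^ i" if "C \<in> generate (G Mod K) {g <# K}" for C
    using that
  proof (induction rule: generate.induct)
    case one
    show ?case by (rule exI[of _ 0]) (simp add: inK)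
  next
    case (incl h)
    thus ?case using lcoset_eq[OF g] by (intro exI[of _ 1]) (simp add: value_fibre_def w_def)
  next
    case (inv h)
    have "h \<in> carrier (G Mod K)"
      using inv g K.coset_eq by (auto simp: FactGroup_def RCOSETS_def)
    hence "inv\<^bsub>G Mod K\<^esub> h = set_inv h" by (rule K.inv_FactGroup)
    moreover have "lam y = w ^ (N - 1)" if "y \<in> set_inv h" for y
    proof -
      from that obtain x where x: "x \<in> h" "y = inv x" by (auto simp: SET_INV_def)
      hence "x \<in> carrier G" "lam x = w" using inv lcoset_eq[OF g] by (auto simp: value_fibre_def w_def)
      moreover have "w * w ^ (N - 1) = 1" using powN[OF g] N by (simp add: w_def flip: power_Suc)
      ultimately show ?thesis using x \<open>\<And>x. x \<in> carrier G \<Longrightarrow> lam (inv x) = inverse (lam x)\<close>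
        by (simp add: inverse_unique)
    qed
    ultimately show ?case by auto
  next
    case (eng h1 h2)
    then obtain i j where ij: "\<forall>y\<in>h1. lam y = w ^ i" "\<forall>y\<in>h2. lam y = w ^ j" by blast
    have sub: "h \<subseteq> carrier G" if "h \<in> generate (G Mod K) {g <# K}" for h
      using that K.rcosets_carrier unfolding gen by (auto simp: FactGroup_def)
    show ?case
      using ij sub[OF eng.hyps(1)] sub[OF eng.hyps(2)]
      by (intro exI[of _ "i + j"]) (auto simp: set_mult_def mult power_add subset_iff)
  qed
  have V_pow: "V = range (\<lambda>i::nat. w ^ i)"
  proof (intro equalityI subsetI)
    fix v assume "v \<in> V"
    then obtain x where x: "x \<in> carrier G" "v = lam x" by (auto simp: V_def)
    hence "K #> x \<in> generate (G Mod K) {g <# K}"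
      unfolding gen by (auto simp: FactGroup_def RCOSETS_def)
    then obtain i :: nat where "\<forall>y\<in>K #> x. lam y = w ^ i" using gen_pow by blast
    moreover have "x \<in> K #> x" using x by (simp add: coset_eq value_fibre_def)
    ultimately have "v = w ^ i" using x(2) by simp
    thus "v \<in> range (\<lambda>i. w ^ i)" by blast
  next
    fix v assume "v \<in> range (\<lambda>i::nat. w ^ i)"
    thus "v \<in> V" using pow[OF g] g by (auto simp: V_def w_def image_iff) (metis nat_pow_closed)
  qed
  have prim: "primitive_root m w"
  proof -
    \<comment> \<open>\<open>r\<close> is the order of \<open>w\<close>. Since \<open>V\<close>
      consists of the powers of \<open>w\<close>, it has \<open>r\<close> elements; it also has
      \<open>m\<close>, so the two agree.\<close>
    define r where "r = (LEAST r. r > 0 \<and> w ^ r = 1)"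
    have r: "r > 0" "w ^ r = 1"
      using LeastI[of "\<lambda>r. r > 0 \<and> w ^ r = 1" N] N powN[OF g] by (auto simp: r_def w_def)
    have least: "s \<ge> r" if "s > 0" "w ^ s = 1" for s
      unfolding r_def using that by (intro Least_le) auto
    have mod: "w ^ d = w ^ (d mod r)" for d
    proof -
      have "w ^ d = w ^ (r * (d div r) + d mod r)" by simp
      also have "\<dots> = w ^ (d mod r)" unfolding power_add power_mult r(2) by simp
      finally show ?thesis .
    qed
    have "w ^ d = 1 \<longleftrightarrow> r dvd d" for d
    proof
      assume "w ^ d = 1"
      hence "w ^ (d mod r) = 1" using mod by simp
      hence "d mod r = 0" using least[of "d mod r"] r(1) by (metis mod_less_divisor not_gr_zero not_le)
      thus "r dvd d" by auto
    qed (use mod r in \<open>auto simp: power_mult elim!: dvdE\<close>)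
    hence prim: "primitive_root r w" using r by (simp add: primitive_root_def)
    have "V = (\<lambda>i. w ^ i) ` {..<r}"
      unfolding V_pow using mod r(1) by (force simp: image_iff)
    hence "card V = r" using card_image[OF primitive_root_inj[OF prim]] by simp
    thus ?thesis using prim cardV by simp
  qed
  have mpos: "m > 0" using prim by (simp add: primitive_root_def)
  have mN: "m dvd N" using prim powN[OF g] by (simp add: primitive_root_def w_def)
  define F where "F i = psi G (value_fibre G lam (w ^ i))" for i
  \<comment> \<open>Divide \<open>i\<close> and \<open>m\<close> by their gcd to get coprime
    \<open>a\<close> and \<open>b\<close>, and lift \<open>a\<close> modulo \<open>b\<close> to
    \<open>k\<close> prime to \<open>N\<close>. The \<open>k\<close>-th power map then carries the
    fibre over \<open>w ^ gcd i m\<close> to the one over \<open>w ^ i\<close>.\<close>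
  have F_gcd: "F i = F (gcd i m)" for i
  proof -
    obtain a b where ab: "i = gcd i m * a" "m = gcd i m * b" "coprime a b"
      using gcd_coprime_exists[of i m] mpos by (metis gcd_eq_0_iff mult.commute not_gr_zero)
    obtain k where k: "coprime k N" "k mod b = a mod b" using lift_coprime[OF ab(3) N] .
    have "(gcd i m * k) mod m = i mod m"
      using k(2) ab(1,2) by (metis mult_mod_right)
    hence wk: "w ^ (gcd i m * k) = w ^ i" using primitive_root_power_eq[OF prim] by blast
    have "F i = psi G (value_fibre G lam (w ^ (gcd i m * k)))" by (simp add: F_def wk)
    also have "\<dots> = F (gcd i m)"
      unfolding F_def
    proof (rule psi_value_fibre_power[OF fin])
      show "coprime k (Coset.order G)" using k by (simp add: N_def)
      fix x assume x: "x \<in> carrier G"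
      then obtain j :: nat where j: "lam x = w ^ j" using V_pow by (auto simp: V_def)
      have "coprime k m" using k(1) mN by (metis coprime_divisors dvd_refl)
      hence "[j * k = gcd i m * k] (mod m) \<longleftrightarrow> [j = gcd i m] (mod m)"
        by (rule cong_mult_rcancel_nat)
      thus "lam (x [^] k) = w ^ (gcd i m * k) \<longleftrightarrow> lam x = w ^ gcd i m"
        by (simp add: pow[OF x] j primitive_root_power_eq[OF prim] cong_def flip: power_mult)
    qed
    finally show ?thesis .
  qed
  have "V = (\<lambda>i. w ^ i) ` {..<m}"
  proof (rule sym, rule card_subset_eq[OF finV])
    show "(\<lambda>i. w ^ i) ` {..<m} \<subseteq> V" by (auto simp: V_pow)
    show "card ((\<lambda>i. w ^ i) ` {..<m}) = card V"
      using card_image[OF primitive_root_inj[OF prim]] cardV by simp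
  qed
  hence "(\<Sum>v\<in>V. v * of_nat (psi G (value_fibre G lam v))) = (\<Sum>i<m. w ^ i * of_nat (F i))"
    by (simp add: sum.reindex[OF primitive_root_inj[OF prim]] F_def)
  also have "\<dots> = (\<Sum>d | d dvd m. \<Sum>i | i < m \<and> gcd i m = d. w ^ i * of_nat (F i))"
    by (rule sum_gcd_classes[OF mpos])
  also have "\<dots> = (\<Sum>d | d dvd m. of_nat (psi G ((g [^] d) <# K)) * of_int (moebius_mu (m div d)))"
  proof (rule sum.cong[OF refl])
    fix d assume "d \<in> {d. d dvd m}"
    hence d: "d dvd m" by simp
    have "(\<Sum>i | i < m \<and> gcd i m = d. w ^ i * of_nat (F i))
        = of_nat (F d) * (\<Sum>i | i < m \<and> gcd i m = d. w ^ i)"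
      unfolding sum_distrib_left by (rule sum.cong) (use F_gcd in \<open>auto simp: mult.commute\<close>)
    also have "(\<Sum>i | i < m \<and> gcd i m = d. w ^ i) = of_int (moebius_mu (m div d))"
      using sum_primitive_powers[OF primitive_root_power_div[OF prim d]]
      unfolding sum_gcd_class_eq[OF mpos d] by (simp add: power_mult)
    also have "F d = psi G ((g [^] d) <# K)"
      using lcoset_eq[of "g [^] d"] pow[OF g] g by (simp add: F_def w_def)
    finally show "(\<Sum>i | i < m \<and> gcd i m = d. w ^ i * of_nat (F i))
        = of_nat (psi G ((g [^] d) <# K)) * of_int (moebius_mu (m div d))" .
  qed
  finally show ?thesis using char_inner_Xi[OF fin, of lam] by (simp add: V_def)
qed

theorem theoremB:
  fixes G :: "('a, 'b) monoid_scheme"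
  assumes "group G" and "finite (carrier G)"
  shows
    "(\<forall>\<chi> R. \<chi> \<in> Irr G \<and> galois_orbit_reps G \<chi> R \<longrightarrow>
        char_inner G (Xi G) \<chi> =
          (\<Sum>\<alpha>\<in>R. of_nat (psi G (value_fibre G \<chi> \<alpha>)) * of_rat (field_trace (rat_adjoin \<alpha>) \<alpha>)))
     \<and>
     (\<forall>lam K m g.
        lam \<in> Irr G \<and> linear_char G lam \<and> K = char_ker G lam \<and> m = card (rcosets\<^bsub>G\<^esub> K) \<and>
        g \<in> carrier G \<and> generate (G Mod K) {g <#\<^bsub>G\<^esub> K} = carrier (G Mod K) \<longrightarrow>
        char_inner G (Xi G) lam =
          (\<Sum>d | d dvd m. of_nat (psi G ((g [^]\<^bsub>G\<^esub> d) <#\<^bsub>G\<^esub> K)) * of_int (moebius_mu (m div d))))"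
proof -
  interpret group G by fact
  show ?thesis
    using char_inner_Xi_trace[OF assms(2)] char_inner_Xi_linear[OF assms(2)] by blast
qed

end
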